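(* Let $D\subset\mathbb{R}^d$ be open and let $\Omega\subset D$ be a smoothly $1$-cracked set such that $\Omega=\tilde\Omega\setminus\Sigma$, where $\tilde\Omega\subset\mathbb{R}^d$ is an open and bounded set with $C^\infty$-boundary and $M:=\Sigma\subset\tilde\Omega$ is a closed, bounded and simply connected $1$-dimensional $C^\infty$-submanifold of $\mathbb{R}^d$ with boundary $\partial M=\{A,B\}$. Let $J$ be a real-valued shape function and suppose that the Eulerian semi-derivative $dJ(\Omega)(X)$ exists for all $X\in C^1_c(\tilde\Omega,\mathbb{R}^d)$ and that $dJ(\Omega):C^1_c(\tilde\Omega,\mathbb{R}^d)\to\mathbb{R}$ is continuous and linear. Let $(\mathfrak{n}_1,\ldots,\mathfrak{n}_{d-1})$ be a smooth orthonormal frame along $M$ satisfying $\operatorname{span}\{\mathfrak{n}_1(p),\ldots,\mathfrak{n}_{d-1}(p)\}=(T_pM)^\bot$ for all $p\in M$. Then there are continuous and linear functionals $\bar h_1,\ldots,\bar h_{d-1}:C^1(M)\to\mathbb{R}$ and real numbers $\alpha_1,\alpha_2$ such that $$dJ(\Omega)(X)=\alpha_1(X\cdot\nu)(A)+\alpha_2(X\cdot\nu)(B)+\sum_{i=1}^{d-1}\bar h_i(X|_M\cdot\mathfrak{n}_i)\qquad\text{for all }X\in C^1_c(\tilde\Omega,\mathbb{R}^d),$$ where $\nu$ is the outward-pointing unit vector field on $\partial M$.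
   Context: A closed, bounded, simply connected (in particular connected) $1$-dimensional submanifold with boundary $\{A,B\}$ is an embedded compact arc with end points $A,B$. For $p\in\partial M$, $\nu(p)$ is the unit vector in the tangent line $T_pM$ pointing out of $M$. Eulerian semi-derivative: for $X\in C^1_c(\tilde\Omega,\mathbb{R}^d)$ ($C^1$ vector fields with compact support in $\tilde\Omega$), $\Phi_t$ denotes the flow of $X$, $\frac{d}{dt}\Phi_t(x)=X(\Phi_t(x))$, $\Phi_0(x)=x$. For a function $J:\Xi\to\mathbb{R}$ on a set $\Xi$ of subsets of $\mathbb{R}^d$ and $\Omega\in\Xi$ such that $\Phi_t(\Omega)\in\Xi$ for all small $t>0$, $$dJ(\Omega)(X):=\lim_{t\searrow0}\frac{J(\Phi_t(\Omega))-J(\Omega)}{t}.$$ Continuity on $C^1_c(\tilde\Omega,\mathbb{R}^d)$ is with respect to the seminorms $\|f\|_{K,\alpha}=\sup_{x\in K}|\partial^\alpha f(x)|$, $K\subset\tilde\Omega$ compact, $|\alpha|\le1$. $C^1(M)$ carries its usual $C^1$-norm. *)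

theory Defs
  imports "HOL-Analysis.Analysis"
begin

section \<open>Functions of class \<open>C\<^sup>k\<close>, submanifolds with boundary\<close>

primrec Cn_on :: "nat \<Rightarrow> 'a::euclidean_space set \<Rightarrow> ('a \<Rightarrow> 'b::euclidean_space) \<Rightarrow> bool" where
  "Cn_on 0 U f \<longleftrightarrow> continuous_on U f"
| "Cn_on (Suc n) U f \<longleftrightarrow>
     (\<forall>x\<in>U. f differentiable (at x)) \<and> (\<forall>v. Cn_on n U (\<lambda>x. frechet_derivative f (at x) v))"

text \<open>Meant for open \<open>U\<close>; \<open>k = \<infinity>\<close> is \<open>C\<^sup>\<infinity>\<close>.\<close>

definition Ck_on :: "enat \<Rightarrow> 'a::euclidean_space set \<Rightarrow> ('a \<Rightarrow> 'b::euclidean_space) \<Rightarrow> bool" where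
  "Ck_on k U f \<longleftrightarrow> (\<forall>n. enat n \<le> k \<longrightarrow> Cn_on n U f)"

text \<open>Class \<open>C\<^sup>k\<close> along a subset \<open>M\<close> of Euclidean space: local \<open>C\<^sup>k\<close> extensions exist.
  The values of \<open>f\<close> off \<open>M\<close> are irrelevant.\<close>

definition Ck_along :: "enat \<Rightarrow> 'a::euclidean_space set \<Rightarrow> ('a \<Rightarrow> 'b::euclidean_space) \<Rightarrow> bool" where
  "Ck_along k M f \<longleftrightarrow>
     (\<forall>p\<in>M. \<exists>U F. open U \<and> p \<in> U \<and> Ck_on k U F \<and> (\<forall>x\<in>M \<inter> U. F x = f x))"

definition smooth_diffeo ::
  "'a::euclidean_space set \<Rightarrow> 'a set \<Rightarrow> ('a \<Rightarrow> 'a) \<Rightarrow> bool" where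
  "smooth_diffeo U V \<phi> \<longleftrightarrow> open U \<and> open V \<and> bij_betw \<phi> U V \<and>
     Ck_on \<infinity> U \<phi> \<and> Ck_on \<infinity> V (inv_into U \<phi>)"

text \<open>Near an interior point a submanifold is straightened to a \<open>k\<close>-dimensional linear subspace
  \<open>S\<close>, near a boundary point to a closed half-space \<open>{x \<in> S. x \<bullet> e \<ge> 0}\<close> of \<open>S\<close>, the point itself
  being mapped to the face \<open>x \<bullet> e = 0\<close>.\<close>

definition mfd_interior_point :: "nat \<Rightarrow> 'a::euclidean_space set \<Rightarrow> 'a \<Rightarrow> bool" where
  "mfd_interior_point k M p \<longleftrightarrow> p \<in> M \<and>
     (\<exists>U V \<phi> S. smooth_diffeo U V \<phi> \<and> p \<in> U \<and> subspace S \<and> dim S = k \<and>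
        \<phi> ` (M \<inter> U) = S \<inter> V)"

definition mfd_boundary_point :: "nat \<Rightarrow> 'a::euclidean_space set \<Rightarrow> 'a \<Rightarrow> bool" where
  "mfd_boundary_point k M p \<longleftrightarrow> p \<in> M \<and>
     (\<exists>U V \<phi> S e. smooth_diffeo U V \<phi> \<and> p \<in> U \<and> subspace S \<and> dim S = k \<and>
        e \<in> S \<and> norm e = 1 \<and> \<phi> ` (M \<inter> U) = {x \<in> S. x \<bullet> e \<ge> 0} \<inter> V \<and> \<phi> p \<bullet> e = 0)"

definition smooth_submanifold :: "nat \<Rightarrow> 'a::euclidean_space set \<Rightarrow> bool" where
  "smooth_submanifold k M \<longleftrightarrow> (\<forall>p\<in>M. mfd_interior_point k M p \<or> mfd_boundary_point k M p)"

definition mfd_boundary :: "nat \<Rightarrow> 'a::euclidean_space set \<Rightarrow> 'a set" where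
  "mfd_boundary k M = {p. mfd_boundary_point k M p}"

text \<open>An open set with \<open>C\<^sup>\<infinity>\<close>-boundary lies locally on one side of its boundary.  As \<open>\<phi>\<close> is a
  homeomorphism, the condition forces \<open>\<phi>\<close> to map \<open>U \<inter> frontier W\<close> onto \<open>{x \<in> V. x \<bullet> e = 0}\<close>.\<close>

definition smooth_boundary :: "'a::euclidean_space set \<Rightarrow> bool" where
  "smooth_boundary W \<longleftrightarrow>
     (\<forall>p\<in>frontier W. \<exists>U V \<phi> e. smooth_diffeo U V \<phi> \<and> p \<in> U \<and> norm e = 1 \<and>
        \<phi> ` (W \<inter> U) = {x. x \<bullet> e > 0} \<inter> V)"

section \<open>Tangent spaces and outward unit vectors\<close>

text \<open>One-sided velocities at \<open>p\<close> of curves in \<open>M\<close> starting at \<open>p\<close>.  For a submanifold they form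
  the whole tangent space at an interior point, and the closed half of it pointing into \<open>M\<close>
  at a boundary point.\<close>

definition inward_velocities :: "'a::euclidean_space set \<Rightarrow> 'a \<Rightarrow> 'a set" where
  "inward_velocities M p =
     {v. \<exists>c \<epsilon>. \<epsilon> > 0 \<and> c 0 = p \<and> c ` {0..\<epsilon>} \<subseteq> M \<and>
        (c has_vector_derivative v) (at (0::real) within {0..\<epsilon>})}"

definition tangent_space :: "'a::euclidean_space set \<Rightarrow> 'a \<Rightarrow> 'a set" where
  "tangent_space M p = span (inward_velocities M p)"

text \<open>For boundary points of one-dimensional submanifolds, where the tangent space is a line.\<close>

definition outward_unit :: "'a::euclidean_space set \<Rightarrow> 'a \<Rightarrow> 'a \<Rightarrow> bool" where
  "outward_unit M p v \<longleftrightarrow> v \<in> tangent_space M p \<and> norm v = 1 \<and> v \<notin> inward_velocities M p"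

section \<open>Function spaces and their topologies\<close>

definition linear_functional_on :: "('a \<Rightarrow> 'b::real_vector) set \<Rightarrow> (('a \<Rightarrow> 'b) \<Rightarrow> real) \<Rightarrow> bool" where
  "linear_functional_on V T \<longleftrightarrow>
     (\<forall>f\<in>V. \<forall>g\<in>V. T (\<lambda>x. f x + g x) = T f + T g) \<and>
     (\<forall>f\<in>V. \<forall>c. T (\<lambda>x. c *\<^sub>R f x) = c * T f)"

text \<open>The locally convex topology on the function space \<open>V\<close> given by the seminorms \<open>P\<close>.\<close>

definition seminorm_topology ::
  "('a \<Rightarrow> 'b::real_vector) set \<Rightarrow> (('a \<Rightarrow> 'b) \<Rightarrow> real) set \<Rightarrow> ('a \<Rightarrow> 'b) topology" where
  "seminorm_topology V P =
     topology_generated_by {{g \<in> V. p (\<lambda>x. g x - f x) < e} | f p e. f \<in> V \<and> p \<in> P \<and> e > 0}"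

text \<open>\<open>C\<^sup>1\<close> vector fields with compact support in \<open>W\<close>, extended by zero to the whole space.\<close>

definition C1c :: "(real^'n) set \<Rightarrow> (real^'n \<Rightarrow> real^'n) set" where
  "C1c W = {X. Ck_on 1 UNIV X \<and> compact (closure {x. X x \<noteq> 0}) \<and> closure {x. X x \<noteq> 0} \<subseteq> W}"

definition partial :: "'n \<Rightarrow> (real^'n \<Rightarrow> real^'n) \<Rightarrow> real^'n \<Rightarrow> real^'n" where
  "partial i X x = frechet_derivative X (at x) (axis i 1)"

definition C1c_seminorms :: "(real^'n) set \<Rightarrow> ((real^'n \<Rightarrow> real^'n) \<Rightarrow> real) set" where
  "C1c_seminorms W =
     {\<lambda>X. SUP x\<in>K. norm (X x) | K. compact K \<and> K \<noteq> {} \<and> K \<subseteq> W} \<union>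
     {\<lambda>X. SUP x\<in>K. norm (partial i X x) | K i. compact K \<and> K \<noteq> {} \<and> K \<subseteq> W}"

definition C1c_topology :: "(real^'n) set \<Rightarrow> (real^'n \<Rightarrow> real^'n) topology" where
  "C1c_topology W = seminorm_topology (C1c W) (C1c_seminorms W)"

text \<open>Elements of \<open>C\<^sup>1(M)\<close> are represented by total functions whose values off \<open>M\<close> do not matter.
  A linear functional that is continuous for the \<open>C\<^sup>1\<close>-norm below vanishes on all functions
  that are zero on \<open>M\<close>, so it is a functional of the restriction to \<open>M\<close>.\<close>

definition C1 :: "'a::euclidean_space set \<Rightarrow> ('a \<Rightarrow> real) set" where
  "C1 M = {f. Ck_along 1 M f}"

text \<open>Supremum of \<open>\<bar>f\<bar>\<close> plus supremum of the operator norm of the differential of \<open>f\<close> on the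
  tangent spaces.  The derivative within \<open>M\<close> is not unique as a linear map on the ambient space,
  but its values on the tangent space are.\<close>

definition C1_norm :: "'a::euclidean_space set \<Rightarrow> ('a \<Rightarrow> real) \<Rightarrow> real" where
  "C1_norm M f = (SUP p\<in>M. \<bar>f p\<bar>) +
     (SUP p\<in>M. SUP v\<in>{v \<in> tangent_space M p. norm v \<le> 1}. \<bar>frechet_derivative f (at p within M) v\<bar>)"

definition C1_topology :: "'a::euclidean_space set \<Rightarrow> ('a \<Rightarrow> real) topology" where
  "C1_topology M = seminorm_topology (C1 M) {C1_norm M}"

section \<open>Eulerian semi-derivative\<close>

definition is_flow :: "('a::euclidean_space \<Rightarrow> 'a) \<Rightarrow> (real \<Rightarrow> 'a \<Rightarrow> 'a) \<Rightarrow> bool" where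
  "is_flow X \<Phi> \<longleftrightarrow>
     (\<forall>x. \<Phi> 0 x = x \<and> (\<forall>t. ((\<lambda>s. \<Phi> s x) has_vector_derivative X (\<Phi> t x)) (at t)))"

text \<open>The shape function \<open>J\<close> is only meaningful on the set \<open>\<Xi>\<close> of admissible shapes.
  The existential quantifier involves no choice: a compactly supported \<open>C\<^sup>1\<close> field has
  exactly one (global) flow.\<close>

definition has_eulerian_semideriv ::
  "'a::euclidean_space set set \<Rightarrow> ('a set \<Rightarrow> real) \<Rightarrow> 'a set \<Rightarrow> ('a \<Rightarrow> 'a) \<Rightarrow> real \<Rightarrow> bool" where
  "has_eulerian_semideriv \<Xi> J \<Omega> X L \<longleftrightarrow>
     (\<exists>\<Phi>. is_flow X \<Phi> \<and> \<Omega> \<in> \<Xi> \<and> (\<forall>\<^sub>F t in at_right 0. \<Phi> t ` \<Omega> \<in> \<Xi>) \<and>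
        ((\<lambda>t. (J (\<Phi> t ` \<Omega>) - J \<Omega>) / t) \<longlongrightarrow> L) (at_right 0))"

definition eulerian_semideriv ::
  "'a::euclidean_space set set \<Rightarrow> ('a set \<Rightarrow> real) \<Rightarrow> 'a set \<Rightarrow> ('a \<Rightarrow> 'a) \<Rightarrow> real" where
  "eulerian_semideriv \<Xi> J \<Omega> X = (THE L. has_eulerian_semideriv \<Xi> J \<Omega> X L)"

end

(*
  If X is tangential to M and vanishes at A and B, its flow preserves M (the end points are
  stationary; elsewhere the distance to M along the flow obeys a linear differential inequality)
  and preserves the exterior of W, so it fixes \<Omega> and dJ(\<Omega>)(X) = 0. In particular dJ(\<Omega>) only sees
  the restriction of X to M, and a functional h_i on C^1(M) is obtained by applying dJ(\<Omega>) to any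
  extension of f n_i to W; it is continuous because the extension can be chosen with C^1-norm
  bounded by a multiple of that of f. Subtracting from X extensions of its normal components and
  multiples of two tangential fields that equal \<nu> at one end point and vanish at the other leaves
  a tangential field vanishing at A and B. If A = B, the second of the two fields is zero.
*)

theory Submission
  imports Defs
begin

section \<open>Maps of class \<open>C\<^sup>1\<close>\<close>

text \<open>Two obstacles shape the proof. The norm of C^1(M) sees derivatives along M only, whereas
  the seminorms on fields see all partial derivatives; and at an end point a chart knows f on a half
  line of parameters only. Therefore f is extended as a function of the chart parameter alone,
  continued past an end point by odd reflection, and all constants are fixed before f is chosen. No
  linear extension operator is needed: since dJ kills fields that vanish on M, its value is the same
  for every extension, which yields linearity, and continuity comes from a bounded extension of a
  difference g - f. The distance to M is not differentiable on M. Its role is taken by the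
  displacement \<open>x - c (\<tau> x)\<close> of x from the point with the same chart parameter.
  This foot point is certain to lie on M only in charts without boundary, which is why end points
  must be handled by stationarity.\<close>

definition C1_map :: "'a::euclidean_space set \<Rightarrow> ('a \<Rightarrow> 'b::euclidean_space) \<Rightarrow> bool" where
  "C1_map U f \<longleftrightarrow> (\<forall>x\<in>U. f differentiable (at x)) \<and>
     (\<forall>v. continuous_on U (\<lambda>x. frechet_derivative f (at x) v))"

lemma C1_mapI:
  assumes "\<And>x. x \<in> U \<Longrightarrow> (f has_derivative f' x) (at x)"
    and "\<And>v. continuous_on U (\<lambda>x. f' x v)"
  shows "C1_map U f"
proof -
  have eq: "frechet_derivative f (at x) = f' x" if "x \<in> U" for x
    using frechet_derivative_at[OF assms(1)[OF that]] by simp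
  have "continuous_on U (\<lambda>x. frechet_derivative f (at x) v)" for v
    using assms(2)[of v] by (rule continuous_on_eq) (simp add: eq)
  then show ?thesis
    using assms(1) unfolding C1_map_def differentiable_def by blast
qed

lemma C1_map_has_derivative:
  "C1_map U f \<Longrightarrow> x \<in> U \<Longrightarrow> (f has_derivative frechet_derivative f (at x)) (at x)"
  by (simp add: C1_map_def flip: frechet_derivative_works)

lemma C1_map_continuous_derivative:
  "C1_map U f \<Longrightarrow> continuous_on U (\<lambda>x. frechet_derivative f (at x) v)"
  by (simp add: C1_map_def)

lemma C1_map_continuous_on:
  assumes "C1_map U f" shows "continuous_on U f"
  using C1_map_has_derivative[OF assms] has_derivative_continuous continuous_at_imp_continuous_on
  by blast

text \<open>\<open>Ck_on 1\<close> asks for levels 0 and 1 of \<open>Cn_on\<close>. Level 0,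
  continuity, follows from differentiability; level 1 agrees with \<open>C1_map\<close> because both
  ask for continuity of the derivative in each fixed direction.\<close>

lemma Ck_on_1_iff: "Ck_on 1 U f \<longleftrightarrow> C1_map U f"
proof -
  have "Ck_on 1 U f \<longleftrightarrow> Cn_on 0 U f \<and> Cn_on (Suc 0) U f"
    unfolding Ck_on_def one_enat_def enat_ord_simps
    by (metis One_nat_def le_Suc_eq le_zero_eq)
  then show ?thesis
    using C1_map_continuous_on[of U f] by (auto simp: C1_map_def)
qed

lemma C1_map_subset: "C1_map U f \<Longrightarrow> V \<subseteq> U \<Longrightarrow> C1_map V f"
  unfolding C1_map_def by (blast intro: continuous_on_subset)

lemma C1_map_Un:
  "C1_map U f \<Longrightarrow> C1_map V f \<Longrightarrow> open U \<Longrightarrow> open V \<Longrightarrow> C1_map (U \<union> V) f"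
  unfolding C1_map_def by (auto intro: continuous_on_open_Un)

text \<open>\<open>frechet_derivative\<close> is a choice from the set of derivatives. Functions
  that agree near \<open>x\<close> have the same set, hence the same choice, even where neither is
  differentiable.\<close>

lemma frechet_derivative_eq_on_open:
  assumes "open U" "x \<in> U" "\<And>y. y \<in> U \<Longrightarrow> f y = g y"
  shows "frechet_derivative f (at x) = frechet_derivative g (at x)"
proof -
  have "(f has_derivative D) (at x) \<longleftrightarrow> (g has_derivative D) (at x)" for D
    using assms by (metis has_derivative_transform_within_open)
  then show ?thesis by (simp add: frechet_derivative_def)
qed

lemma C1_map_cong:
  assumes f: "C1_map U f" and U: "open U" and eq: "\<And>y. y \<in> U \<Longrightarrow> f y = g y"
  shows "C1_map U g"
proof (rule C1_mapI)
  show "(g has_derivative frechet_derivative f (at x)) (at x)" if "x \<in> U" for x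
    using C1_map_has_derivative[OF f that] U that eq
    by (rule has_derivative_transform_within_open)
qed (rule C1_map_continuous_derivative[OF f])

lemma linear_eq_sum_Basis:
  assumes "linear f"
  shows "f v = (\<Sum>b\<in>Basis. (v \<bullet> b) *\<^sub>R f b)"
proof -
  have "f v = f (\<Sum>b\<in>Basis. (v \<bullet> b) *\<^sub>R b)" by (simp add: euclidean_representation)
  also have "\<dots> = (\<Sum>b\<in>Basis. (v \<bullet> b) *\<^sub>R f b)"
    by (simp add: linear_sum[OF assms] linear_scale[OF assms])
  finally show ?thesis .
qed

text \<open>Separately continuous in the point and linear in the direction, hence jointly continuous.\<close>

lemma C1_map_continuous_derivative_compose:
  assumes g: "C1_map V g" and f: "continuous_on U f" "f ` U \<subseteq> V" and w: "continuous_on U w"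
  shows "continuous_on U (\<lambda>x. frechet_derivative g (at (f x)) (w x))"
proof -
  have eq: "frechet_derivative g (at (f x)) (w x) =
      (\<Sum>b\<in>Basis. (w x \<bullet> b) *\<^sub>R frechet_derivative g (at (f x)) b)" if "x \<in> U" for x
  proof -
    have "linear (frechet_derivative g (at (f x)))"
      using C1_map_has_derivative[OF g] f that
      by (meson has_derivative_linear image_subset_iff)
    then show ?thesis by (rule linear_eq_sum_Basis)
  qed
  have "continuous_on U (\<lambda>x. \<Sum>b\<in>Basis. (w x \<bullet> b) *\<^sub>R frechet_derivative g (at (f x)) b)"
    using f by (intro continuous_intros w continuous_on_compose2[OF C1_map_continuous_derivative[OF g]])
  then show ?thesis
    by (rule continuous_on_eq) (simp add: eq)
qed

lemma C1_map_compose: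
  assumes g: "C1_map V g" and f: "C1_map U f" "f ` U \<subseteq> V"
  shows "C1_map U (\<lambda>x. g (f x))"
proof (rule C1_mapI)
  show "((\<lambda>x. g (f x)) has_derivative
      (\<lambda>v. frechet_derivative g (at (f x)) (frechet_derivative f (at x) v))) (at x)" if "x \<in> U" for x
    using diff_chain_at[OF C1_map_has_derivative[OF f(1) that] C1_map_has_derivative[OF g]] f(2) that
    by (auto simp: o_def)
  show "continuous_on U (\<lambda>x. frechet_derivative g (at (f x)) (frechet_derivative f (at x) v))" for v
    by (intro C1_map_continuous_derivative_compose[OF g] C1_map_continuous_on f
        C1_map_continuous_derivative)
qed

lemma C1_map_bilinear:
  assumes h: "bounded_bilinear h" and f: "C1_map U f" and g: "C1_map U g"
  shows "C1_map U (\<lambda>x. h (f x) (g x))"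
proof (rule C1_mapI)
  show "((\<lambda>x. h (f x) (g x)) has_derivative
      (\<lambda>v. h (f x) (frechet_derivative g (at x) v) + h (frechet_derivative f (at x) v) (g x))) (at x)"
    if "x \<in> U" for x
    using bounded_bilinear.FDERIV[OF h C1_map_has_derivative[OF f that] C1_map_has_derivative[OF g that]] .
  show "continuous_on U (\<lambda>x. h (f x) (frechet_derivative g (at x) v) +
      h (frechet_derivative f (at x) v) (g x))" for v
    by (intro continuous_intros bounded_bilinear.continuous_on[OF h]
        C1_map_continuous_derivative f g C1_map_continuous_on[OF f] C1_map_continuous_on[OF g])
qed

lemma C1_map_bounded_linear: "bounded_linear f \<Longrightarrow> C1_map U f"
  by (rule C1_mapI[where f' = "\<lambda>_. f"]) (auto intro: bounded_linear_imp_has_derivative)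

lemma C1_map_const: "C1_map U (\<lambda>x. a)"
  by (rule C1_mapI[where f' = "\<lambda>_ _. 0"]) auto

lemma C1_map_ident: "C1_map U (\<lambda>x. x)"
  by (rule C1_map_bounded_linear) (rule bounded_linear_ident)

lemma C1_map_add:
  assumes f: "C1_map U f" and g: "C1_map U g"
  shows "C1_map U (\<lambda>x. f x + g x)"
proof (rule C1_mapI)
  show "((\<lambda>x. f x + g x) has_derivative
      (\<lambda>v. frechet_derivative f (at x) v + frechet_derivative g (at x) v)) (at x)" if "x \<in> U" for x
    by (intro has_derivative_add C1_map_has_derivative[OF f that] C1_map_has_derivative[OF g that])
  show "continuous_on U (\<lambda>x. frechet_derivative f (at x) v + frechet_derivative g (at x) v)" for v
    by (intro continuous_on_add C1_map_continuous_derivative f g)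
qed

lemmas C1_map_scaleR = C1_map_bilinear[OF bounded_bilinear_scaleR]
lemmas C1_map_inner = C1_map_bilinear[OF bounded_bilinear_inner]

lemma C1_map_diff:
  "C1_map U f \<Longrightarrow> C1_map U g \<Longrightarrow> C1_map U (\<lambda>x. f x - g x)"
  using C1_map_add[of U f "\<lambda>x. (-1) *\<^sub>R g x"] C1_map_scaleR[OF C1_map_const[of U "-1"], of g]
  by simp

text \<open>Linearity reduces all directions to the basis vectors, where a continuous function on a
  compact set is bounded; \<open>B\<close> is the sum of these finitely many bounds.\<close>

lemma C1_map_derivative_bound:
  assumes f: "C1_map U f" and K: "compact K" "K \<subseteq> U"
  obtains B where "B \<ge> 0" "\<And>x v. x \<in> K \<Longrightarrow> norm (frechet_derivative f (at x) v) \<le> B * norm v"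
proof -
  have "\<exists>B. \<forall>x\<in>K. norm (frechet_derivative f (at x) b) \<le> B" for b
  proof -
    have "continuous_on K (\<lambda>x. frechet_derivative f (at x) b)"
      using C1_map_continuous_derivative[OF f] K continuous_on_subset by blast
    then have "bounded ((\<lambda>x. frechet_derivative f (at x) b) ` K)"
      using K compact_continuous_image compact_imp_bounded by blast
    then show ?thesis by (auto simp: bounded_iff)
  qed
  then obtain B where B: "\<And>b x. x \<in> K \<Longrightarrow> norm (frechet_derivative f (at x) b) \<le> B b"
    by metis
  show thesis
  proof
    show "0 \<le> (\<Sum>b\<in>Basis. \<bar>B b\<bar>)" by (simp add: sum_nonneg)
    fix x v assume x: "x \<in> K"
    have lin: "linear (frechet_derivative f (at x))"
      using C1_map_has_derivative[OF f] K x by (meson has_derivative_linear subsetD)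
    have "frechet_derivative f (at x) v = (\<Sum>b\<in>Basis. (v \<bullet> b) *\<^sub>R frechet_derivative f (at x) b)"
      by (rule linear_eq_sum_Basis[OF lin])
    also have "norm \<dots> \<le> (\<Sum>b\<in>Basis. norm v * \<bar>B b\<bar>)"
    proof (rule sum_norm_le)
      fix b :: 'a assume b: "b \<in> Basis"
      have "\<bar>v \<bullet> b\<bar> \<le> norm v" using Basis_le_norm[OF b] .
      moreover have "norm (frechet_derivative f (at x) b) \<le> \<bar>B b\<bar>" using B[OF x, of b] by linarith
      ultimately show "norm ((v \<bullet> b) *\<^sub>R frechet_derivative f (at x) b) \<le> norm v * \<bar>B b\<bar>"
        by (simp add: mult_mono)
    qed
    finally show "norm (frechet_derivative f (at x) v) \<le> (\<Sum>b\<in>Basis. \<bar>B b\<bar>) * norm v"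
      by (simp add: sum_distrib_left mult.commute)
  qed
qed

lemma C1_map_lipschitz:
  assumes f: "C1_map U f" and K: "compact K" "convex K" "K \<subseteq> U"
  obtains L where "L \<ge> 0" "\<And>x y. x \<in> K \<Longrightarrow> y \<in> K \<Longrightarrow> norm (f x - f y) \<le> L * norm (x - y)"
proof -
  obtain B where B: "B \<ge> 0" "\<And>x v. x \<in> K \<Longrightarrow> norm (frechet_derivative f (at x) v) \<le> B * norm v"
    using C1_map_derivative_bound[OF f K(1,3)] by blast
  have "norm (f x - f y) \<le> B * norm (x - y)" if "x \<in> K" "y \<in> K" for x y
  proof (rule differentiable_bound[OF K(2) _ _ that])
    show "(f has_derivative frechet_derivative f (at z)) (at z within K)" if "z \<in> K" for z
      using C1_map_has_derivative[OF f] K that by (meson has_derivative_at_withinI subsetD)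
    show "onorm (frechet_derivative f (at z)) \<le> B" if "z \<in> K" for z
      by (rule onorm_bound) (use B that in auto)
  qed
  with B(1) show thesis by (rule that)
qed

text \<open>The full ambient derivative is bounded, since the seminorms on fields involve all
  partial derivatives. A single constant for values and derivatives makes it easy to keep all
  estimates linear in \<open>C1_norm M f\<close>.\<close>

definition C1_bounded :: "'a::euclidean_space set \<Rightarrow> ('a \<Rightarrow> 'b::euclidean_space) \<Rightarrow> real \<Rightarrow> bool" where
  "C1_bounded U f B \<longleftrightarrow> C1_map U f \<and>
     (\<forall>x\<in>U. norm (f x) \<le> B \<and> (\<forall>v. norm (frechet_derivative f (at x) v) \<le> B * norm v))"

lemma C1_boundedI:
  assumes "C1_map U f"
    and "\<And>x. x \<in> U \<Longrightarrow> norm (f x) \<le> B"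
    and "\<And>x. x \<in> U \<Longrightarrow> (f has_derivative f' x) (at x)"
    and "\<And>x v. x \<in> U \<Longrightarrow> norm (f' x v) \<le> B * norm v"
  shows "C1_bounded U f B"
  using assms(1,2,4) frechet_derivative_at[OF assms(3)] by (simp add: C1_bounded_def)

lemma C1_boundedD:
  assumes "C1_bounded U f B" "x \<in> U"
  shows "norm (f x) \<le> B" and "norm (frechet_derivative f (at x) v) \<le> B * norm v"
  using assms by (simp_all add: C1_bounded_def)

lemma C1_map_bounded:
  assumes f: "C1_map U f" and K: "compact K" "K \<subseteq> U"
  obtains B where "B \<ge> 0" "C1_bounded K f B"
proof -
  obtain B where B: "B \<ge> 0" "\<And>x v. x \<in> K \<Longrightarrow> norm (frechet_derivative f (at x) v) \<le> B * norm v"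
    using C1_map_derivative_bound[OF assms] by blast
  have "compact (f ` K)"
    using C1_map_continuous_on[OF f] K continuous_on_subset compact_continuous_image by blast
  then obtain C where C: "\<And>x. x \<in> K \<Longrightarrow> norm (f x) \<le> C"
    using compact_imp_bounded[of "f ` K"] by (auto simp: bounded_iff)
  have "norm (frechet_derivative f (at x) v) \<le> max B C * norm v" if "x \<in> K" for x v
    using B(2)[OF that, of v] mult_right_mono[of B "max B C" "norm v"] by simp
  then have "C1_bounded K f (max B C)"
    using C C1_map_subset[OF f K(2)] by (simp add: C1_bounded_def le_max_iff_disj)
  moreover have "0 \<le> max B C" using B(1) by simp
  ultimately show thesis using that by blast
qed

lemma C1_bounded_subset: "C1_bounded U f B \<Longrightarrow> V \<subseteq> U \<Longrightarrow> C1_bounded V f B"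
  unfolding C1_bounded_def using C1_map_subset by blast

lemma C1_bounded_add:
  assumes f: "C1_bounded U f B" and g: "C1_bounded U g C"
  shows "C1_bounded U (\<lambda>x. f x + g x) (B + C)"
proof (rule C1_boundedI)
  show "C1_map U (\<lambda>x. f x + g x)"
    using f g by (auto simp: C1_bounded_def intro: C1_map_add)
  show "norm (f x + g x) \<le> B + C" if "x \<in> U" for x
    using f g that by (simp add: C1_bounded_def norm_add_rule_thm)
  show "((\<lambda>x. f x + g x) has_derivative
      (\<lambda>v. frechet_derivative f (at x) v + frechet_derivative g (at x) v)) (at x)" if "x \<in> U" for x
    using f g that unfolding C1_bounded_def by (intro has_derivative_add C1_map_has_derivative) auto
  show "norm (frechet_derivative f (at x) v + frechet_derivative g (at x) v) \<le> (B + C) * norm v"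
    if "x \<in> U" for x v
    using f g that by (simp add: C1_bounded_def distrib_right norm_add_rule_thm)
qed

text \<open>Each of the two terms of the product rule is at most \<open>B * C * norm v\<close>,
  whence the factor 2.\<close>

lemma C1_bounded_scaleR:
  assumes f: "C1_bounded U f B" and g: "C1_bounded U g C" and nonneg: "B \<ge> 0" "C \<ge> 0"
  shows "C1_bounded U (\<lambda>x. f x *\<^sub>R g x) (2 * B * C)"
proof (rule C1_boundedI)
  show "C1_map U (\<lambda>x. f x *\<^sub>R g x)"
    using f g by (auto simp: C1_bounded_def intro: C1_map_scaleR)
  have fb: "\<bar>f x\<bar> \<le> B" and gb: "norm (g x) \<le> C" if "x \<in> U" for x
    using f g that by (auto simp: C1_bounded_def)
  have BC: "0 \<le> B * C" using nonneg by simp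
  show "norm (f x *\<^sub>R g x) \<le> 2 * B * C" if "x \<in> U" for x
  proof -
    have "\<bar>f x\<bar> * norm (g x) \<le> B * C"
      using fb[OF that] gb[OF that] nonneg by (intro mult_mono) auto
    then show ?thesis using BC by simp
  qed
  show "((\<lambda>x. f x *\<^sub>R g x) has_derivative
      (\<lambda>v. f x *\<^sub>R frechet_derivative g (at x) v + frechet_derivative f (at x) v *\<^sub>R g x)) (at x)"
    if "x \<in> U" for x
    using f g that unfolding C1_bounded_def by (intro has_derivative_scaleR C1_map_has_derivative) auto
  show "norm (f x *\<^sub>R frechet_derivative g (at x) v + frechet_derivative f (at x) v *\<^sub>R g x)
      \<le> 2 * B * C * norm v" if x: "x \<in> U" for x v
  proof -
    have "norm (f x *\<^sub>R frechet_derivative g (at x) v) \<le> B * (C * norm v)"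
      using mult_mono[OF fb[OF x], of "norm (frechet_derivative g (at x) v)" "C * norm v"] g x nonneg
      by (simp add: C1_bounded_def)
    moreover have "norm (frechet_derivative f (at x) v *\<^sub>R g x) \<le> (B * norm v) * C"
      using mult_mono[OF _ gb[OF x], of "\<bar>frechet_derivative f (at x) v\<bar>" "B * norm v"] f x nonneg
      by (simp add: C1_bounded_def)
    ultimately have "norm (f x *\<^sub>R frechet_derivative g (at x) v + frechet_derivative f (at x) v *\<^sub>R g x)
        \<le> B * (C * norm v) + (B * norm v) * C"
      by (rule norm_add_rule_thm)
    then show ?thesis by (simp add: algebra_simps)
  qed
qed

section \<open>Flows preserving a closed set\<close>

text \<open>By Cauchy-Schwarz the derivative of \<open>z t \<bullet> z t\<close> is at most
  \<open>2 * L\<close> times this quantity, so the weight \<open>exp (- 2 * L * t)\<close> makes it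
  nonincreasing. Being nonnegative and 0 at the start, it stays 0.\<close>

lemma gronwall_zero_forward:
  fixes z :: "real \<Rightarrow> 'a::real_inner"
  assumes ab: "a \<le> b"
    and z: "\<And>t. t \<in> {a..b} \<Longrightarrow> (z has_vector_derivative z' t) (at t)"
    and le: "\<And>t. t \<in> {a..b} \<Longrightarrow> norm (z' t) \<le> L * norm (z t)"
    and "z a = 0"
  shows "z b = 0"
proof -
  define u where "u t = (z t \<bullet> z t) * exp (- 2 * L * t)" for t
  have "\<exists>y. (u has_real_derivative y) (at t) \<and> y \<le> 0" if t: "a \<le> t" "t \<le> b" for t
  proof (intro exI conjI)
    have zt: "(z has_derivative (\<lambda>h. h *\<^sub>R z' t)) (at t)"
      using z[of t] t by (simp add: has_vector_derivative_def)
    show "(u has_real_derivative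
        (2 * (z t \<bullet> z' t) - 2 * L * (z t \<bullet> z t)) * exp (- 2 * L * t)) (at t)"
      unfolding u_def has_field_derivative_def
      by (rule derivative_eq_intros zt refl)+
        (auto simp: fun_eq_iff algebra_simps inner_commute)
    have "z t \<bullet> z' t \<le> norm (z t) * (L * norm (z t))"
      using norm_cauchy_schwarz[of "z t" "z' t"] mult_left_mono[OF le[of t] norm_ge_zero[of "z t"]] t
      by simp
    then have "2 * (z t \<bullet> z' t) - 2 * L * (z t \<bullet> z t) \<le> 0"
      by (simp add: dot_square_norm power2_eq_square algebra_simps)
    then show "(2 * (z t \<bullet> z' t) - 2 * L * (z t \<bullet> z t)) * exp (- 2 * L * t) \<le> 0"
      by (simp add: mult_nonpos_nonneg)
  qed
  from DERIV_nonpos_imp_nonincreasing[OF ab this]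
  have "u b \<le> 0" using \<open>z a = 0\<close> by (simp add: u_def)
  then have "z b \<bullet> z b \<le> 0"
    by (simp add: u_def mult_le_0_iff not_le)
  then show ?thesis
    by (metis inner_eq_zero_iff inner_ge_zero order_antisym)
qed

text \<open>The zero may occur at any time of the interval: later times use the forward estimate,
  earlier ones the time-reversed curve, which obeys the same inequality.\<close>

lemma gronwall_zero:
  fixes z :: "real \<Rightarrow> 'a::real_inner"
  assumes z: "\<And>t. t \<in> {a..b} \<Longrightarrow> (z has_vector_derivative z' t) (at t)"
    and le: "\<And>t. t \<in> {a..b} \<Longrightarrow> norm (z' t) \<le> L * norm (z t)"
    and s: "z s = 0" "s \<in> {a..b}" and t: "t \<in> {a..b}"
  shows "z t = 0"
proof (cases "s \<le> t")
  case True
  then show ?thesis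
    using gronwall_zero_forward[of s t z z' L] z le s t by auto
next
  case False
  have "((\<lambda>r. z (- r)) has_vector_derivative - z' (- r)) (at r)" if "r \<in> {-s..-t}" for r
  proof -
    have "(uminus has_vector_derivative - 1) (at r)"
      by (auto intro!: derivative_eq_intros simp flip: has_real_derivative_iff_has_vector_derivative)
    from vector_diff_chain_at[OF this z[of "- r"]] show ?thesis
      using that s t by (simp add: o_def)
  qed
  then show ?thesis
    using gronwall_zero_forward[of "-s" "-t" "\<lambda>r. z (- r)" "\<lambda>r. - z' (- r)" L] le s t False by auto
qed

text \<open>The derivative vanishes on the open complement of \<open>K\<close>, so the bound on
  \<open>K\<close> holds everywhere and the mean value inequality applies on the whole space. A
  global constant gives uniqueness of trajectories for all times.\<close>

lemma C1_map_compact_support_lipschitz: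
  assumes X: "C1_map UNIV X" and K: "compact K" and zero: "\<And>x. x \<notin> K \<Longrightarrow> X x = 0"
  obtains L where "L \<ge> 0" "\<And>x y. norm (X x - X y) \<le> L * norm (x - y)"
proof -
  obtain B where B: "B \<ge> 0" "\<And>x v. x \<in> K \<Longrightarrow> norm (frechet_derivative X (at x) v) \<le> B * norm v"
    using C1_map_derivative_bound[OF X K] by auto
  have "frechet_derivative X (at x) v = 0" if "x \<notin> K" for x v
    using frechet_derivative_eq_on_open[of "- K" x X "\<lambda>_. 0"] K zero that
    by (simp add: compact_imp_closed open_Compl)
  then have le: "norm (frechet_derivative X (at x) v) \<le> B * norm v" for x v
    using B by (cases "x \<in> K") auto
  have "norm (X x - X y) \<le> B * norm (x - y)" for x y
    by (rule differentiable_bound[of UNIV X "\<lambda>x. frechet_derivative X (at x)"])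
      (auto intro: C1_map_has_derivative[OF X] has_derivative_at_withinI onorm_bound le B)
  with B(1) show thesis by (rule that)
qed

lemma lipschitz_ode_unique:
  fixes u w :: "real \<Rightarrow> 'a::euclidean_space"
  assumes lip: "\<And>x y. norm (X x - X y) \<le> L * norm (x - y)"
    and u: "\<And>t. (u has_vector_derivative X (u t)) (at t)"
    and w: "\<And>t. (w has_vector_derivative X (w t)) (at t)"
    and eq: "u s = w s"
  shows "u t = w t"
proof -
  have "u t - w t = 0"
  proof (rule gronwall_zero[where z = "\<lambda>t. u t - w t" and a = "min s t" and b = "max s t"])
    show "((\<lambda>t. u t - w t) has_vector_derivative X (u r) - X (w r)) (at r)" for r
      by (intro has_vector_derivative_diff u w)
    show "norm (X (u r) - X (w r)) \<le> L * norm (u r - w r)" for r by (rule lip)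
  qed (use eq in auto)
  then show ?thesis by simp
qed

text \<open>\<open>is_flow\<close> records only the differential equation and the initial value. The
  group law comes from uniqueness: both sides solve the same equation in \<open>s\<close> and agree
  at \<open>s = 0\<close>.\<close>

lemma is_flow_add:
  assumes lip: "\<And>x y. norm (X x - X y) \<le> L * norm (x - y)" and \<Phi>: "is_flow X \<Phi>"
  shows "\<Phi> s (\<Phi> t x) = \<Phi> (s + t) x"
proof (rule lipschitz_ode_unique[OF lip, where u = "\<lambda>s. \<Phi> s (\<Phi> t x)" and s = 0])
  have flow: "((\<lambda>s. \<Phi> s y) has_vector_derivative X (\<Phi> r y)) (at r)" for r y
    using \<Phi> by (simp add: is_flow_def)
  show "((\<lambda>s. \<Phi> s (\<Phi> t x)) has_vector_derivative X (\<Phi> r (\<Phi> t x))) (at r)" for r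
    by (rule flow)
  show "((\<lambda>s. \<Phi> (s + t) x) has_vector_derivative X (\<Phi> (r + t) x)) (at r)" for r
  proof -
    have "((\<lambda>s. s + t) has_vector_derivative 1) (at r)"
      by (auto intro!: derivative_eq_intros simp flip: has_real_derivative_iff_has_vector_derivative)
    from vector_diff_chain_at[OF this flow] show ?thesis by (simp add: o_def)
  qed
  show "\<Phi> 0 (\<Phi> t x) = \<Phi> (0 + t) x" using \<Phi> by (simp add: is_flow_def)
qed

lemma is_flow_stationary:
  assumes lip: "\<And>x y. norm (X x - X y) \<le> L * norm (x - y)" and \<Phi>: "is_flow X \<Phi>" and "X x = 0"
  shows "\<Phi> t x = x"
  by (rule lipschitz_ode_unique[OF lip, where u = "\<lambda>s. \<Phi> s x" and s = 0])
    (use assms in \<open>auto simp: is_flow_def\<close>)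

text \<open>\<open>\<psi>\<close> is a local defining function of \<open>M\<close>; along the flow it satisfies a linear differential
  inequality, so that Gronwall keeps it zero.\<close>

lemma is_flow_preserves_closed:
  assumes lip: "\<And>x y. norm (X x - X y) \<le> L * norm (x - y)" and \<Phi>: "is_flow X \<Phi>" and M: "closed M"
    and loc: "\<And>p. p \<in> M \<Longrightarrow> X p = 0 \<or> (\<exists>r>0. \<exists>C. \<exists>\<psi> :: 'a::euclidean_space \<Rightarrow> 'a. \<exists>\<psi>'. \<forall>x\<in>ball p r.
      (\<psi> has_derivative \<psi>' x) (at x) \<and> norm (\<psi>' x (X x)) \<le> C * norm (\<psi> x) \<and> (\<psi> x = 0 \<longleftrightarrow> x \<in> M))"
    and x: "x \<in> M"
  shows "\<Phi> t x \<in> M"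
proof -
  have flow: "((\<lambda>s. \<Phi> s x) has_vector_derivative X (\<Phi> r x)) (at r)" for r
    using \<Phi> by (simp add: is_flow_def)
  have cont: "isCont (\<lambda>s. \<Phi> s x) r" for r
    using flow by (rule has_vector_derivative_continuous)
  \<comment> \<open>The set of times spent in \<open>M\<close> is closed because \<open>M\<close>
    is, and open by Gronwall; the real line is connected.\<close>
  define S where "S = {s. \<Phi> s x \<in> M}"
  have "closed S"
    using continuous_closed_vimage[OF M cont] by (simp add: S_def vimage_def)
  moreover have "open S"
    unfolding open_contains_ball
  proof
    fix s assume s: "s \<in> S"
    let ?p = "\<Phi> s x"
    show "\<exists>e>0. ball s e \<subseteq> S"
    proof (cases "X ?p = 0")
      case True
      have "\<Phi> t x \<in> M" for t
        using is_flow_add[OF lip \<Phi>, of "t - s" s x] is_flow_stationary[OF lip \<Phi> True, of "t - s"] s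
        by (simp add: S_def)
      then show ?thesis unfolding S_def by (intro exI[of _ 1]) auto
    next
      case False
      have "?p \<in> M" using s by (simp add: S_def)
      from loc[OF this] False obtain r C and \<psi> :: "'a \<Rightarrow> 'a" and \<psi>' where r: "r > 0"
        and *: "\<forall>x\<in>ball ?p r. (\<psi> has_derivative \<psi>' x) (at x) \<and>
          norm (\<psi>' x (X x)) \<le> C * norm (\<psi> x) \<and> (\<psi> x = 0 \<longleftrightarrow> x \<in> M)"
        by (elim disjE exE conjE) simp_all
      have \<psi>: "(\<psi> has_derivative \<psi>' y) (at y)"
        and le: "norm (\<psi>' y (X y)) \<le> C * norm (\<psi> y)"
        and iff: "\<psi> y = 0 \<longleftrightarrow> y \<in> M" if "y \<in> ball ?p r" for y
        using * that by simp_all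
      obtain d where d: "d > 0" "\<And>t. dist t s < d \<Longrightarrow> dist (\<Phi> t x) ?p < r"
        using r cont[of s] unfolding continuous_at_eps_delta by blast
      \<comment> \<open>Halving \<open>d\<close> keeps a whole closed interval, as Gronwall
        requires, inside the times at which \<psi> is controlled.\<close>
      have near: "\<Phi> t x \<in> ball ?p r" if "t \<in> {s - d/2 .. s + d/2}" for t
        using d(2)[of t] d(1) that by (auto simp: dist_commute dist_real_def abs_if split: if_splits)
      have "\<Phi> t x \<in> M" if t: "t \<in> ball s (d/2)" for t
      proof -
        have "\<psi> (\<Phi> t x) = 0"
        proof (rule gronwall_zero[where z = "\<lambda>t. \<psi> (\<Phi> t x)"])
          show "((\<lambda>t. \<psi> (\<Phi> t x)) has_vector_derivative \<psi>' (\<Phi> q x) (X (\<Phi> q x))) (at q)"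
            if "q \<in> {s - d/2 .. s + d/2}" for q
            using vector_derivative_diff_chain_within[of "\<lambda>t. \<Phi> t x" _ q UNIV \<psi> "\<psi>' (\<Phi> q x)"]
              flow has_derivative_at_withinI[OF \<psi>[OF near[OF that]]] by (simp add: o_def)
          show "norm (\<psi>' (\<Phi> q x) (X (\<Phi> q x))) \<le> C * norm (\<psi> (\<Phi> q x))"
            if "q \<in> {s - d/2 .. s + d/2}" for q
            by (rule le[OF near[OF that]])
          show "\<psi> (\<Phi> s x) = 0" using iff[of ?p] r s by (simp add: S_def)
        qed (use d(1) t in \<open>auto simp: dist_real_def abs_if split: if_splits\<close>)
        moreover have "\<Phi> t x \<in> ball ?p r"
          by (rule near) (use t in \<open>auto simp: dist_real_def abs_if split: if_splits\<close>)
        ultimately show ?thesis using iff by blast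
      qed
      then show ?thesis using d(1) by (intro exI[of _ "d/2"]) (auto simp: S_def)
    qed
  qed
  moreover have "0 \<in> S" using x \<Phi> by (simp add: S_def is_flow_def)
  ultimately have "S = UNIV" using clopen[of S] by auto
  then show ?thesis by (auto simp: S_def)
qed

text \<open>Points outside \<open>W\<close> are stationary, so a point of \<open>W\<close> that left
  \<open>W\<close> could not return to its origin under the reversed flow. Invariance of
  \<open>M\<close> at negative times keeps points off \<open>M\<close> likewise. The reverse
  inclusion is the inclusion at time \<open>- t\<close>.\<close>

lemma is_flow_image_diff:
  assumes lip: "\<And>x y. norm (X x - X y) \<le> L * norm (x - y)" and \<Phi>: "is_flow X \<Phi>"
    and W: "\<And>x. x \<notin> W \<Longrightarrow> X x = 0"
    and M: "\<And>x t. x \<in> M \<Longrightarrow> \<Phi> t x \<in> M"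
  shows "\<Phi> t ` (W - M) = W - M"
proof -
  have inv: "\<Phi> (- t) (\<Phi> t x) = x" for t x
  proof -
    have "\<Phi> (- t) (\<Phi> t x) = \<Phi> (- t + t) x" by (rule is_flow_add[OF lip \<Phi>])
    then show ?thesis using \<Phi> by (simp add: is_flow_def)
  qed
  have sub: "\<Phi> t ` (W - M) \<subseteq> W - M" for t
  proof
    fix y assume "y \<in> \<Phi> t ` (W - M)"
    then obtain x where x: "x \<in> W" "x \<notin> M" "y = \<Phi> t x" by blast
    have "y \<in> W"
    proof (rule ccontr)
      assume "y \<notin> W"
      then have "\<Phi> (- t) y = y" by (intro is_flow_stationary[OF lip \<Phi>] W)
      then have "y = x" using inv[of t x] x(3) by simp
      with x(1) \<open>y \<notin> W\<close> show False by simp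
    qed
    moreover have "y \<notin> M"
    proof
      assume "y \<in> M"
      then have "\<Phi> (- t) y \<in> M" by (rule M)
      then show False using inv[of t x] x(2,3) by simp
    qed
    ultimately show "y \<in> W - M" by blast
  qed
  have "W - M \<subseteq> \<Phi> t ` (W - M)"
  proof
    fix x assume "x \<in> W - M"
    then have "\<Phi> (- t) x \<in> W - M" using sub[of "- t"] by (meson image_subset_iff)
    moreover have "x = \<Phi> t (\<Phi> (- t) x)" using inv[of "- t" x] by simp
    ultimately show "x \<in> \<Phi> t ` (W - M)" by (rule rev_image_eqI)
  qed
  with sub[of t] show ?thesis by (rule subset_antisym)
qed

section \<open>Charts of one-dimensional submanifolds\<close>

text \<open>The second conclusion makes chart velocities and chart derivatives differentiable
  themselves; the Lipschitz estimate for tangential fields rests on this.\<close>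

lemma C1_map_of_smooth:
  assumes "Ck_on \<infinity> U f"
  shows "C1_map U f" and "C1_map U (\<lambda>x. frechet_derivative f (at x) v)"
proof -
  have Cn: "Cn_on n U f" for n using assms by (simp add: Ck_on_def)
  show "C1_map U f" using Cn[of "Suc 0"] by (simp add: C1_map_def)
  show "C1_map U (\<lambda>x. frechet_derivative f (at x) v)"
    using Cn[of "Suc (Suc 0)"] by (simp add: C1_map_def)
qed

lemma has_vector_derivative_chain_C1_map:
  assumes "C1_map U f" "\<gamma> s \<in> U" "(\<gamma> has_vector_derivative v) (at s within A)"
  shows "((\<lambda>t. f (\<gamma> t)) has_vector_derivative frechet_derivative f (at (\<gamma> s)) v) (at s within A)"
  using vector_derivative_diff_chain_within[OF assms(3) has_derivative_at_withinI[OF C1_map_has_derivative[OF assms(1,2)]]]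
  by (simp add: o_def)

text \<open>A parametrization \<open>c\<close> of a one-dimensional \<open>M\<close> near \<open>p\<close> with a left inverse \<open>\<tau>\<close> defined
  on an ambient ball; the parameters belonging to \<open>M\<close> are those in \<open>I\<close>, a half line at a
  boundary point.\<close>

locale arc_chart =
  fixes M :: "'a::euclidean_space set" and p :: 'a and r \<delta> :: real
    and c c' :: "real \<Rightarrow> 'a" and \<tau> :: "'a \<Rightarrow> real" and I :: "real set"
  assumes r_pos: "r > 0" and \<delta>_pos: "\<delta> > 0" and p_in: "p \<in> M" and \<tau>_p: "\<tau> p = 0"
    and I_cases: "I = UNIV \<or> I = {0..}"
    and c_deriv: "\<And>s. \<bar>s\<bar> < \<delta> \<Longrightarrow> (c has_vector_derivative c' s) (at s)"
    and c'_C1: "C1_map {-\<delta><..<\<delta>} c'"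
    and \<tau>_C1: "C1_map (ball p r) \<tau>"
    and \<tau>_deriv_C1: "\<And>v. C1_map (ball p r) (\<lambda>x. frechet_derivative \<tau> (at x) v)"
    and \<tau>_less: "\<And>x. x \<in> ball p r \<Longrightarrow> \<bar>\<tau> x\<bar> < \<delta>"
    and c_\<tau>: "\<And>x. x \<in> M \<Longrightarrow> x \<in> ball p r \<Longrightarrow> c (\<tau> x) = x"
    and \<tau>_in: "\<And>x. x \<in> M \<Longrightarrow> x \<in> ball p r \<Longrightarrow> \<tau> x \<in> I"
    and c_in: "\<And>s. \<bar>s\<bar> < \<delta> \<Longrightarrow> s \<in> I \<Longrightarrow> c s \<in> M"
begin

lemma c_C1: "C1_map {-\<delta><..<\<delta>} c"
  by (rule C1_mapI[where f' = "\<lambda>s h. h *\<^sub>R c' s"])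
    (use c_deriv in \<open>auto simp: has_vector_derivative_def abs_less_iff
      intro!: continuous_intros C1_map_continuous_on[OF c'_C1]\<close>)

lemma \<tau>_maps: "\<tau> ` ball p r \<subseteq> {-\<delta><..<\<delta>}"
proof (rule image_subsetI)
  show "\<tau> x \<in> {-\<delta><..<\<delta>}" if "x \<in> ball p r" for x
    using \<tau>_less[OF that] by (simp add: abs_less_iff)
qed

text \<open>Near time 0 the curve equals \<open>c (\<tau> (\<gamma> t))\<close>, so the chain rule
  computes its velocity a second time, and one-sided derivatives are unique.\<close>

lemma inward_velocity_eq:
  assumes x: "x \<in> M" "x \<in> ball p r" and v: "v \<in> inward_velocities M x"
  shows "v = frechet_derivative \<tau> (at x) v *\<^sub>R c' (\<tau> x)"
proof -
  obtain \<gamma> \<epsilon> where \<epsilon>: "\<epsilon> > 0" and \<gamma>: "\<gamma> 0 = x" "\<gamma> ` {0..\<epsilon>} \<subseteq> M"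
    and deriv: "(\<gamma> has_vector_derivative v) (at (0::real) within {0..\<epsilon>})"
    using v unfolding inward_velocities_def by blast
  let ?w = "frechet_derivative \<tau> (at x) v *\<^sub>R c' (\<tau> x)"
  have "((\<lambda>t. \<tau> (\<gamma> t)) has_vector_derivative frechet_derivative \<tau> (at x) v) (at 0 within {0..\<epsilon>})"
    using has_vector_derivative_chain_C1_map[OF \<tau>_C1 _ deriv] \<gamma>(1) x(2) by simp
  moreover have "(c has_derivative (\<lambda>h. h *\<^sub>R c' (\<tau> (\<gamma> 0)))) (at (\<tau> (\<gamma> 0)) within (\<lambda>t. \<tau> (\<gamma> t)) ` {0..\<epsilon>})"
    using c_deriv[OF \<tau>_less[OF x(2)]] \<gamma>(1)
    by (simp add: has_vector_derivative_def has_derivative_at_withinI)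
  ultimately have chain: "((\<lambda>t. c (\<tau> (\<gamma> t))) has_vector_derivative ?w) (at 0 within {0..\<epsilon>})"
    using vector_derivative_diff_chain_within[of "\<lambda>t. \<tau> (\<gamma> t)" _ 0 "{0..\<epsilon>}" c] \<gamma>(1)
    by (simp add: o_def)
  have "continuous (at 0 within {0..\<epsilon>}) \<gamma>"
    using deriv by (rule has_vector_derivative_continuous)
  \<comment> \<open>The margin \<open>r - dist p x\<close> keeps \<gamma> inside the ball on which
    \<open>c\<close> inverts \<tau> along \<open>M\<close>.\<close>
  then obtain d where d: "d > 0" "\<And>t. t \<in> {0..\<epsilon>} \<Longrightarrow> dist t 0 < d \<Longrightarrow> dist (\<gamma> t) x < r - dist p x"
    using x(2) \<gamma>(1) unfolding continuous_within_eps_delta mem_ball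
    by (metis diff_gt_0_iff_gt)
  have "(\<gamma> has_vector_derivative ?w) (at 0 within {0..\<epsilon>})"
  proof (rule has_vector_derivative_transform_within[OF chain d(1)])
    fix t :: real assume t: "t \<in> {0..\<epsilon>}" "dist t 0 < d"
    have "\<gamma> t \<in> ball p r"
      using d(2)[OF t] dist_triangle[of p "\<gamma> t" x] by (simp add: dist_commute)
    then show "c (\<tau> (\<gamma> t)) = \<gamma> t" using c_\<tau> \<gamma>(2) t(1) by blast
  qed (use \<epsilon> in auto)
  moreover have "at (0::real) within {0..\<epsilon>} \<noteq> bot"
    using \<epsilon> by (simp add: trivial_limit_within islimpt_Icc)
  ultimately show ?thesis
    using vector_derivative_unique_within deriv by blast
qed

text \<open>The curve moves forward in the parameter: \<open>I\<close> is closed under adding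
  nonnegative numbers in both of its forms, so the curve stays in \<open>M\<close> even when it
  starts at an end point.\<close>

lemma velocity_in:
  assumes s: "\<bar>s\<bar> < \<delta>" "s \<in> I"
  shows "c' s \<in> inward_velocities M (c s)"
proof -
  define \<epsilon> where "\<epsilon> = (\<delta> - s) / 2"
  have \<epsilon>: "\<epsilon> > 0" using s by (simp add: \<epsilon>_def)
  have "((\<lambda>t. s + t) has_vector_derivative 1) (at 0)"
    by (auto intro!: derivative_eq_intros simp flip: has_real_derivative_iff_has_vector_derivative)
  from vector_diff_chain_at[OF this, of c "c' s"] c_deriv[OF s(1)]
  have "((\<lambda>t. c (s + t)) has_vector_derivative c' s) (at 0 within {0..\<epsilon>})"
    by (simp add: o_def has_vector_derivative_at_within)
  moreover have "c (s + t) \<in> M" if "t \<in> {0..\<epsilon>}" for t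
  proof (rule c_in)
    have "s + t \<le> (s + \<delta>) / 2" using that by (simp add: \<epsilon>_def field_simps)
    then show "\<bar>s + t\<bar> < \<delta>" using s that by auto
    show "s + t \<in> I" using I_cases s(2) that by auto
  qed
  ultimately show ?thesis
    using \<epsilon> unfolding inward_velocities_def by (intro CollectI exI[of _ "\<lambda>t. c (s + t)"] exI[of _ \<epsilon>]) auto
qed

lemma velocity_in_tangent_space: "\<bar>s\<bar> < \<delta> \<Longrightarrow> s \<in> I \<Longrightarrow> c' s \<in> tangent_space M (c s)"
  using velocity_in by (simp add: tangent_space_def span_base)

text \<open>Both sides are linear in \<open>v\<close>, so the identity passes from velocities to
  their span. It places the tangent space in the line of \<open>c'\<close> and reads off the
  coefficient.\<close>

lemma tangent_eq:
  assumes x: "x \<in> M" "x \<in> ball p r" and v: "v \<in> tangent_space M x"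
  shows "v = frechet_derivative \<tau> (at x) v *\<^sub>R c' (\<tau> x)"
proof -
  have lin: "linear (frechet_derivative \<tau> (at x))"
    using C1_map_has_derivative[OF \<tau>_C1 x(2)] by (rule has_derivative_linear)
  show ?thesis
    using v unfolding tangent_space_def
  proof (induction rule: span_induct_alt)
    case base
    then show ?case by (simp add: linear_0[OF lin])
  next
    case (step a y z)
    then show ?case
      using inward_velocity_eq[OF x step(1)]
      by (simp add: linear_add[OF lin] linear_scale[OF lin] scaleR_add_left)
         (metis scaleR_scaleR)
  qed
qed

end

text \<open>One construction serves both kinds of points. \<open>S\<close> is the line spanned by
  \<open>e\<close>; \<open>c\<close> is the inverse chart along this line and \<tau> the coordinate
  in direction \<open>e\<close>. Measuring from \<open>\<phi> p\<close> puts \<open>p\<close> at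
  parameter 0, so a boundary chart gives the half line starting there.\<close>

lemma arc_chart_exists:
  fixes M :: "'a::euclidean_space set"
  assumes \<phi>: "smooth_diffeo U V \<phi>" and p: "p \<in> U" "p \<in> M" and S: "subspace S" "dim S = 1"
    and e: "e \<in> S" "norm e = 1" and I: "I = UNIV \<or> I = {0..}"
    and img: "\<phi> ` (M \<inter> U) = {x \<in> S. (x - \<phi> p) \<bullet> e \<in> I} \<inter> V"
  obtains r \<delta> c c' \<tau> where "arc_chart M p r \<delta> c c' \<tau> I"
proof -
  define \<psi> where "\<psi> = inv_into U \<phi>"
  define q where "q = \<phi> p"
  have U: "open U" and V: "open V" and bij: "bij_betw \<phi> U V"
    and \<phi>': "Ck_on \<infinity> U \<phi>" and \<psi>': "Ck_on \<infinity> V \<psi>"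
    using \<phi> by (auto simp: smooth_diffeo_def \<psi>_def)
  have \<psi>\<phi>: "\<psi> (\<phi> x) = x" if "x \<in> U" for x
    using bij that by (simp add: \<psi>_def bij_betw_inv_into_left)
  have e1: "e \<bullet> e = 1" using e(2) by (simp add: dot_square_norm)
  have "span {e} = S"
    using e S by (intro subspace_dim_equal) (auto simp: span_minimal)
  then have S_eq: "x = (x \<bullet> e) *\<^sub>R e" if "x \<in> S" for x
    using that e1 by (auto simp: span_singleton)
  have q: "q \<in> V" "q \<in> S" using p img by (auto simp: q_def)
  obtain \<delta> where \<delta>: "\<delta> > 0" "ball q \<delta> \<subseteq> V"
    using V q(1) open_contains_ball by blast
  have cont: "continuous_on U \<phi>" using C1_map_of_smooth(1)[OF \<phi>'] by (rule C1_map_continuous_on)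
  have "open (U \<inter> \<phi> -` ball q \<delta>)"
    using continuous_open_preimage[OF cont U] by blast
  \<comment> \<open>\<open>r\<close> is so small that \<phi> maps the ball into
    \<open>ball q \<delta>\<close>; as \<open>e\<close> is a unit vector, this bounds \<tau> by
    \<delta>.\<close>
  then obtain r where r: "r > 0" "ball p r \<subseteq> U \<inter> \<phi> -` ball q \<delta>"
    using p(1) \<delta>(1) unfolding open_contains_ball by (force simp: q_def)
  define c where "c s = \<psi> (q + s *\<^sub>R e)" for s
  define c' where "c' s = frechet_derivative \<psi> (at (q + s *\<^sub>R e)) e" for s
  define \<tau> where "\<tau> x = (\<phi> x - q) \<bullet> e" for x
  have line: "q + s *\<^sub>R e \<in> V" if "\<bar>s\<bar> < \<delta>" for s
    using \<delta>(2) that e(2) by (auto simp: dist_norm)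
  have affine: "C1_map {-\<delta><..<\<delta>} (\<lambda>s. q + s *\<^sub>R e)"
    by (intro C1_map_add C1_map_scaleR C1_map_const C1_map_ident)
  have \<tau>_deriv: "(\<tau> has_derivative (\<lambda>v. frechet_derivative \<phi> (at x) v \<bullet> e)) (at x)" if "x \<in> U" for x
    unfolding \<tau>_def
    using C1_map_has_derivative[OF C1_map_of_smooth(1)[OF \<phi>'] that]
    by (auto intro!: derivative_eq_intros)
  have \<tau>_frechet: "frechet_derivative \<tau> (at x) v = frechet_derivative \<phi> (at x) v \<bullet> e" if "x \<in> U" for x v
    using frechet_derivative_at[OF \<tau>_deriv[OF that]] by metis
  have "arc_chart M p r \<delta> c c' \<tau> I"
  proof
    show "(c has_vector_derivative c' s) (at s)" if "\<bar>s\<bar> < \<delta>" for s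
    proof -
      have "((\<lambda>s. q + s *\<^sub>R e) has_vector_derivative e) (at s)"
        by (auto simp: has_vector_derivative_def intro!: derivative_eq_intros)
      from has_vector_derivative_chain_C1_map[OF C1_map_of_smooth(1)[OF \<psi>'] line[OF that] this]
      show ?thesis by (simp add: c_def[abs_def] c'_def)
    qed
    show "C1_map {-\<delta><..<\<delta>} c'"
      unfolding c'_def[abs_def]
      by (rule C1_map_compose[OF C1_map_of_smooth(2)[OF \<psi>'] affine]) (use line in auto)
    show "C1_map (ball p r) \<tau>"
      unfolding \<tau>_def[abs_def]
      by (intro C1_map_inner C1_map_diff C1_map_const C1_map_subset[OF C1_map_of_smooth(1)[OF \<phi>']])
        (use r in auto)
    show "C1_map (ball p r) (\<lambda>x. frechet_derivative \<tau> (at x) v)" for v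
    proof (rule C1_map_cong)
      show "C1_map (ball p r) (\<lambda>x. frechet_derivative \<phi> (at x) v \<bullet> e)"
        by (intro C1_map_inner C1_map_const C1_map_subset[OF C1_map_of_smooth(2)[OF \<phi>']])
          (use r in auto)
    qed (use \<tau>_frechet r in auto)
    show "\<bar>\<tau> x\<bar> < \<delta>" if "x \<in> ball p r" for x
    proof -
      have "norm (\<phi> x - q) < \<delta>" using r that by (auto simp: dist_norm norm_minus_commute)
      then show ?thesis
        using Cauchy_Schwarz_ineq2[of "\<phi> x - q" e] e(2) by (simp add: \<tau>_def)
    qed
    show "c (\<tau> x) = x" "\<tau> x \<in> I" if x: "x \<in> M" "x \<in> ball p r" for x
    proof -
      have xU: "x \<in> U" using r x by auto
      then have \<phi>x: "\<phi> x \<in> S" "(\<phi> x - q) \<bullet> e \<in> I" using img x by (auto simp: q_def)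
      then show "\<tau> x \<in> I" by (simp add: \<tau>_def)
      have "q + \<tau> x *\<^sub>R e = \<phi> x"
        using S_eq[of "\<phi> x - q"] \<phi>x(1) q(2) S(1) by (simp add: \<tau>_def subspace_diff)
      then show "c (\<tau> x) = x" by (simp add: c_def \<psi>\<phi>[OF xU])
    qed
    show "c s \<in> M" if s: "\<bar>s\<bar> < \<delta>" "s \<in> I" for s
    proof -
      have "q + s *\<^sub>R e \<in> S" using S(1) q(2) e(1) by (simp add: subspace_add subspace_scale)
      then have "q + s *\<^sub>R e \<in> \<phi> ` (M \<inter> U)"
        unfolding img using line[OF s(1)] s(2) e1 by (simp add: q_def)
      then obtain x where "x \<in> M" "x \<in> U" "q + s *\<^sub>R e = \<phi> x" by blast
      then show ?thesis by (simp add: c_def \<psi>\<phi>)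
    qed
  qed (use r \<delta> p I in \<open>auto simp: \<tau>_def q_def\<close>)
  then show thesis by (rule that)
qed

lemma arc_chart_interior:
  fixes M :: "'a::euclidean_space set"
  assumes "mfd_interior_point 1 M p"
  obtains r \<delta> c c' \<tau> where "arc_chart M p r \<delta> c c' \<tau> UNIV"
proof -
  obtain U V \<phi> S where *: "p \<in> M" "smooth_diffeo U V \<phi>" "p \<in> U" "subspace S" "dim S = 1"
    "\<phi> ` (M \<inter> U) = S \<inter> V"
    using assms unfolding mfd_interior_point_def by blast
  have "\<not> S \<subseteq> {0}" using *(5) by (metis dim_eq_0 zero_neq_one)
  then obtain x where x: "x \<in> S" "x \<noteq> 0" by blast
  show thesis
    by (rule arc_chart_exists[OF *(2,3,1,4,5), of "x /\<^sub>R norm x" UNIV])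
      (use * x that in \<open>auto simp: subspace_scale\<close>)
qed

lemma arc_chart_boundary:
  fixes M :: "'a::euclidean_space set"
  assumes "mfd_boundary_point 1 M p"
  obtains r \<delta> c c' \<tau> where "arc_chart M p r \<delta> c c' \<tau> {0..}"
proof -
  obtain U V \<phi> S e where *: "p \<in> M" "smooth_diffeo U V \<phi>" "p \<in> U" "subspace S" "dim S = 1"
    "e \<in> S" "norm e = 1" "\<phi> ` (M \<inter> U) = {x \<in> S. x \<bullet> e \<ge> 0} \<inter> V" "\<phi> p \<bullet> e = 0"
    using assms unfolding mfd_boundary_point_def by blast
  show thesis
    by (rule arc_chart_exists[OF *(2,3,1,4-7), of "{0..}"])
      (use * that in \<open>auto simp: inner_diff_left\<close>)
qed

lemma arc_chart_at:
  fixes M :: "'a::euclidean_space set"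
  assumes "smooth_submanifold 1 M" "p \<in> M"
  obtains r \<delta> c c' \<tau> I where "arc_chart M p r \<delta> c c' \<tau> I"
  using assms arc_chart_interior arc_chart_boundary unfolding smooth_submanifold_def by metis

section \<open>Tangential vector fields\<close>

lemma C1_map_sum:
  "finite A \<Longrightarrow> (\<And>i. i \<in> A \<Longrightarrow> C1_map U (f i)) \<Longrightarrow> C1_map U (\<lambda>x. \<Sum>i\<in>A. f i x)"
  by (induction A rule: finite_induct) (simp_all add: C1_map_const C1_map_add)

lemma C1_map_extend_zero:
  assumes f: "C1_map U f" and U: "open U" and K: "closed K" "K \<subseteq> U" and zero: "\<And>x. x \<notin> K \<Longrightarrow> f x = 0"
  shows "C1_map UNIV f"
proof -
  have "C1_map (- K) f"
    using C1_map_const[of "- K" 0] by (rule C1_map_cong) (use K zero in auto)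
  then have "C1_map (U \<union> - K) f"
    using C1_map_Un[OF f _ U] K(1) by blast
  moreover have "U \<union> - K = UNIV" using K(2) by blast
  ultimately show ?thesis by simp
qed

lemma C1_bounded_extend_zero:
  assumes f: "C1_bounded U f B" and B: "B \<ge> 0" and U: "open U" and K: "closed K" "K \<subseteq> U"
    and zero: "\<And>x. x \<notin> K \<Longrightarrow> f x = 0"
  shows "C1_bounded UNIV f B"
proof -
  have "C1_map UNIV f"
    using f C1_map_extend_zero[OF _ U K zero] by (simp add: C1_bounded_def)
  moreover have "frechet_derivative f (at x) v = 0" if "x \<notin> K" for x v
    using frechet_derivative_eq_on_open[of "- K" x f "\<lambda>_. 0"] K(1) zero that
    by (simp add: open_Compl)
  ultimately show ?thesis
    using f K(2) B zero unfolding C1_bounded_def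
    by (metis UNIV_I mult_nonneg_nonneg norm_ge_zero norm_zero subsetD)
qed

lemma C1_map_real:
  fixes f :: "real \<Rightarrow> real"
  assumes "\<And>s. s \<in> U \<Longrightarrow> (f has_real_derivative f' s) (at s)" "continuous_on U f'"
  shows "C1_map U f"
  by (rule C1_mapI[where f' = "\<lambda>s h. f' s * h"])
    (use assms in \<open>auto simp: has_field_derivative_def intro!: continuous_intros\<close>)

text \<open>Squaring removes the kink of the positive part at 0. The cutoff has to be C^1 only, so
  this function suffices as its building block.\<close>

lemma C1_map_power_pos_part: "C1_map U (\<lambda>s::real. (max 0 s)\<^sup>2)"
proof (rule C1_map_real[where f' = "\<lambda>s. 2 * max 0 s"])
  fix s :: real
  consider "s < 0" | "s = 0" | "s > 0" by linarith
  then show "((\<lambda>s. (max 0 s)\<^sup>2) has_real_derivative 2 * max 0 s) (at s)"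
  proof cases
    case 1
    have "((\<lambda>s::real. 0) has_real_derivative 2 * max 0 s) (at s)" using 1 by simp
    then show ?thesis
      by (rule has_field_derivative_transform_within_open[where S = "{..<0}"]) (use 1 in auto)
  next
    case 2
    \<comment> \<open>Caratheodory's form of the derivative: the difference quotient at 0 is
      \<open>max 0\<close> itself, because \<open>(max 0 z)\<^sup>2 = max 0 z * z\<close>.\<close>
    have "\<exists>g. (\<forall>z::real. (max 0 z)\<^sup>2 - (max 0 0)\<^sup>2 = g z * (z - 0)) \<and> isCont g 0 \<and> g 0 = 0"
      by (rule exI[of _ "max 0"]) (auto simp: max_def power2_eq_square intro!: continuous_intros)
    from CARAT_DERIV[of "\<lambda>s. (max 0 s)\<^sup>2" 0 0, THEN iffD2, OF this] show ?thesis
      unfolding 2 by simp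
  next
    case 3
    have "((\<lambda>s::real. s\<^sup>2) has_real_derivative 2 * max 0 s) (at s)"
      using 3 by (auto intro!: derivative_eq_intros)
    then show ?thesis
      by (rule has_field_derivative_transform_within_open[where S = "{0<..}"]) (use 3 in auto)
  qed
qed (intro continuous_intros)

lemma C1_cutoff:
  fixes p :: "'a::euclidean_space"
  assumes r: "r > 0"
  obtains \<eta> :: "'a \<Rightarrow> real" and B where "B \<ge> 0" "C1_bounded UNIV \<eta> B"
    "\<And>x. x \<in> ball p (r/2) \<Longrightarrow> \<eta> x = 1" "\<And>x. x \<notin> cball p r \<Longrightarrow> \<eta> x = 0"
proof -
  define sq where "sq s = (max 0 s)\<^sup>2" for s :: real
  define q where "q x = 2 / r\<^sup>2 * ((x - p) \<bullet> (x - p))" for x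
  \<comment> \<open>For \<open>q x \<le> 1\<close> the inner square is at least 1, so the outer one
    vanishes; for \<open>q x \<ge> 2\<close> the inner one vanishes, so the outer one is 1. The
    factor 2 in \<open>q\<close> makes it 1/2 at distance \<open>r/2\<close> and 2 at distance
    \<open>r\<close>.\<close>
  define \<eta> where "\<eta> x = 1 - sq (1 - sq (2 - q x))" for x
  have sq: "C1_map UNIV sq"
    using C1_map_power_pos_part by (simp add: sq_def[abs_def])
  have "C1_map UNIV q"
    unfolding q_def[abs_def] real_scaleR_def[symmetric]
    by (intro C1_map_scaleR C1_map_inner C1_map_diff C1_map_const C1_map_ident)
  then have \<eta>: "C1_map UNIV \<eta>"
    unfolding \<eta>_def[abs_def]
    by (intro C1_map_diff C1_map_const C1_map_compose[OF sq]) auto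
  have q_eq: "q x = 2 * (dist p x / r)\<^sup>2" for x
  proof -
    have "dist p x = norm (x - p)" by (simp add: dist_norm norm_minus_commute)
    then show ?thesis by (simp add: q_def power2_norm_eq_inner power_divide)
  qed
  have one: "\<eta> x = 1" if "x \<in> ball p (r/2)" for x
  proof -
    have "dist p x / r < 1/2" using r that by (simp add: field_simps)
    then have "(dist p x / r)\<^sup>2 \<le> (1/2)\<^sup>2" using r by (intro power_mono) auto
    moreover have "(1/2)\<^sup>2 = (1/4::real)" by (simp add: power2_eq_square)
    ultimately have "2 - q x \<ge> 1" unfolding q_eq by linarith
    then have "sq (2 - q x) \<ge> 1" by (simp add: sq_def one_le_power)
    then show ?thesis by (simp add: \<eta>_def sq_def[of "1 - sq (2 - q x)"])
  qed
  have zero: "\<eta> x = 0" if "x \<notin> cball p r" for x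
  proof -
    have "1 < dist p x / r" using r that by (simp add: field_simps)
    then have "1 \<le> (dist p x / r)\<^sup>2" by (intro one_le_power) simp
    then have "q x \<ge> 2" unfolding q_eq by linarith
    then show ?thesis by (simp add: \<eta>_def sq_def)
  qed
  \<comment> \<open>The bound is taken on a larger ball because extension by zero wants
    \<open>cball p r\<close> inside an open set on which the bound holds.\<close>
  obtain B where "B \<ge> 0" "C1_bounded (cball p (2*r)) \<eta> B"
    using C1_map_bounded[OF \<eta>, of "cball p (2*r)"] by auto
  have "C1_bounded (ball p (2*r)) \<eta> B"
    using \<open>C1_bounded (cball p (2*r)) \<eta> B\<close> by (rule C1_bounded_subset) (rule ball_subset_cball)
  then have "C1_bounded UNIV \<eta> B"
    by (rule C1_bounded_extend_zero[where K = "cball p r"])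
      (use zero r \<open>B \<ge> 0\<close> in \<open>auto simp: subset_eq\<close>)
  with \<open>B \<ge> 0\<close> show thesis using one zero by (rule that)
qed

text \<open>Any compact subset of \<open>W\<close> off which \<open>X\<close> vanishes can stand in
  for the closed support, so sums and cut-off fields are handled without computing closures.\<close>

lemma C1c_iff:
  "X \<in> C1c W \<longleftrightarrow> C1_map UNIV X \<and> (\<exists>K. compact K \<and> K \<subseteq> W \<and> (\<forall>x. x \<notin> K \<longrightarrow> X x = 0))"
proof -
  have "compact (closure {x. X x \<noteq> 0}) \<and> closure {x. X x \<noteq> 0} \<subseteq> W \<longleftrightarrow>
      (\<exists>K. compact K \<and> K \<subseteq> W \<and> (\<forall>x. x \<notin> K \<longrightarrow> X x = 0))" (is "?l \<longleftrightarrow> ?r")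
  proof
    assume ?l
    then show ?r
      using closure_subset[of "{x. X x \<noteq> 0}"]
      by (intro exI[of _ "closure {x. X x \<noteq> 0}"]) auto
  next
    assume ?r
    then obtain K where K: "compact K" "K \<subseteq> W" "\<forall>x. x \<notin> K \<longrightarrow> X x = 0" by blast
    then have sub: "closure {x. X x \<noteq> 0} \<subseteq> K"
      by (intro closure_minimal) (auto simp: compact_imp_closed)
    then have "compact (closure {x. X x \<noteq> 0})"
      using compact_Int_closed[OF K(1) closed_closure] by (metis inf.absorb2)
    with sub K(2) show ?l by blast
  qed
  then show ?thesis by (simp add: C1c_def Ck_on_1_iff)
qed

lemma C1c_add:
  assumes X: "X \<in> C1c W" and Y: "Y \<in> C1c W"
  shows "(\<lambda>x. X x + Y x) \<in> C1c W"
proof -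
  obtain K L where "compact K" "K \<subseteq> W" "\<forall>x. x \<notin> K \<longrightarrow> X x = 0"
    "compact L" "L \<subseteq> W" "\<forall>x. x \<notin> L \<longrightarrow> Y x = 0"
    using X Y unfolding C1c_iff by blast
  then have "compact (K \<union> L) \<and> K \<union> L \<subseteq> W \<and> (\<forall>x. x \<notin> K \<union> L \<longrightarrow> X x + Y x = 0)"
    by (auto intro: compact_Un)
  then show ?thesis using X Y C1_map_add unfolding C1c_iff by blast
qed

lemma C1c_scaleR: "X \<in> C1c W \<Longrightarrow> (\<lambda>x. a *\<^sub>R X x) \<in> C1c W"
  unfolding C1c_iff using C1_map_scaleR[OF C1_map_const] by (metis scaleR_zero_right)

lemma C1c_zero: "(\<lambda>x. 0) \<in> C1c W"
  unfolding C1c_iff by (intro conjI exI[of _ "{}"]) (auto simp: C1_map_const)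

lemma C1c_diff: "X \<in> C1c W \<Longrightarrow> Y \<in> C1c W \<Longrightarrow> (\<lambda>x. X x - Y x) \<in> C1c W"
  using C1c_add[OF _ C1c_scaleR[of Y W "-1"], of X] by simp

lemma C1c_sum:
  "finite A \<Longrightarrow> (\<And>i. i \<in> A \<Longrightarrow> X i \<in> C1c W) \<Longrightarrow> (\<lambda>x. \<Sum>i\<in>A. X i x) \<in> C1c W"
  by (induction A rule: finite_induct) (simp_all add: C1c_zero C1c_add)

lemma C1c_lipschitz:
  assumes "X \<in> C1c W"
  obtains L where "\<And>x y. norm (X x - X y) \<le> L * norm (x - y)"
  using assms C1_map_compact_support_lipschitz unfolding C1c_iff by metis

text \<open>The displacement \<open>x - c (\<tau> x)\<close> is a local defining function of \<open>M\<close>. Its derivative along a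
  tangential field vanishes on \<open>M\<close> and is Lipschitz, hence is dominated by the displacement.\<close>

lemma (in arc_chart) tangential_field_displacement:
  assumes I: "I = UNIV" and X: "C1_map UNIV X" and tang: "\<And>x. x \<in> M \<Longrightarrow> X x \<in> tangent_space M x"
  shows "\<exists>r>0. \<exists>C. \<exists>\<psi> :: 'a \<Rightarrow> 'a. \<exists>\<psi>'. \<forall>x\<in>ball p r.
      (\<psi> has_derivative \<psi>' x) (at x) \<and> norm (\<psi>' x (X x)) \<le> C * norm (\<psi> x) \<and> (\<psi> x = 0 \<longleftrightarrow> x \<in> M)"
proof -
  define \<psi> where "\<psi> x = x - c (\<tau> x)" for x
  define \<psi>' where "\<psi>' x v = v - frechet_derivative \<tau> (at x) v *\<^sub>R c' (\<tau> x)" for x v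
  have \<tau>_deriv: "(\<tau> has_derivative frechet_derivative \<tau> (at x)) (at x)" if "x \<in> ball p r" for x
    using C1_map_has_derivative[OF \<tau>_C1 that] .
  have \<psi>_deriv: "(\<psi> has_derivative \<psi>' x) (at x)" if "x \<in> ball p r" for x
  proof -
    have "((\<lambda>x. c (\<tau> x)) has_derivative (\<lambda>v. frechet_derivative \<tau> (at x) v *\<^sub>R c' (\<tau> x))) (at x)"
      using diff_chain_at[OF \<tau>_deriv[OF that] c_deriv[OF \<tau>_less[OF that], unfolded has_vector_derivative_def]]
      by (simp add: o_def)
    then show ?thesis
      unfolding \<psi>_def[abs_def] \<psi>'_def[abs_def] by (intro has_derivative_diff has_derivative_ident)
  qed
  have X': "C1_map (ball p r) X" using C1_map_subset[OF X] by simp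
  \<comment> \<open>The derivative of \<tau> is known to be C^1 in fixed directions; expanding
    \<open>X x\<close> in the basis transfers this to the varying direction.\<close>
  have "C1_map (ball p r) (\<lambda>x. \<Sum>b\<in>Basis. (X x \<bullet> b) *\<^sub>R frechet_derivative \<tau> (at x) b)"
    by (intro C1_map_sum C1_map_scaleR C1_map_inner C1_map_const \<tau>_deriv_C1 X') simp
  then have "C1_map (ball p r) (\<lambda>x. frechet_derivative \<tau> (at x) (X x))"
    by (rule C1_map_cong) (auto simp: linear_eq_sum_Basis[OF has_derivative_linear[OF \<tau>_deriv], of _ "X _"])
  from C1_map_diff[OF X' C1_map_scaleR[OF this C1_map_compose[OF c'_C1 \<tau>_C1 \<tau>_maps]]]
  have G: "C1_map (ball p r) (\<lambda>x. \<psi>' x (X x))"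
    by (simp only: \<psi>'_def)
  have sub: "cball p (r/2) \<subseteq> ball p r" using r_pos by (auto simp: subset_eq)
  obtain L where "L \<ge> 0" and L: "\<And>x y. x \<in> cball p (r/2) \<Longrightarrow> y \<in> cball p (r/2) \<Longrightarrow>
      norm (\<psi>' x (X x) - \<psi>' y (X y)) \<le> L * norm (x - y)"
    by (rule C1_map_lipschitz[OF G compact_cball convex_cball sub]) (rule that)
  have "continuous_on (ball p r) (\<lambda>x. c (\<tau> x))"
    by (intro C1_map_continuous_on C1_map_compose[OF c_C1 \<tau>_C1 \<tau>_maps])
  then have cont: "isCont (\<lambda>x. c (\<tau> x)) p"
    using r_pos by (simp add: continuous_on_eq_continuous_at)
  have "c (\<tau> p) = p" using c_\<tau>[OF p_in] r_pos by simp
  \<comment> \<open>Close to \<open>p\<close> the foot \<open>c (\<tau> x)\<close> also lies in the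
    half ball, so the Lipschitz bound applies to \<open>x\<close> and its foot.\<close>
  then obtain d where d: "d > 0" "\<And>x. dist x p < d \<Longrightarrow> dist (c (\<tau> x)) p < r/2"
    using cont[unfolded continuous_at_eps_delta, rule_format, of "r/2"] r_pos by auto
  define \<rho> where "\<rho> = min d (r/2)"
  have "(\<psi> has_derivative \<psi>' x) (at x) \<and> norm (\<psi>' x (X x)) \<le> L * norm (\<psi> x) \<and> (\<psi> x = 0 \<longleftrightarrow> x \<in> M)"
    if x: "x \<in> ball p \<rho>" for x
  proof (intro conjI)
    have xr: "x \<in> ball p r" "x \<in> cball p (r/2)" using x r_pos by (auto simp: \<rho>_def)
    define y where "y = c (\<tau> x)"
    \<comment> \<open>Here \<open>I = UNIV\<close> enters: every parameter belongs to
      \<open>M\<close>, whereas in a half-line chart the foot could lie beyond the end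
      point.\<close>
    have yM: "y \<in> M" using c_in[OF \<tau>_less[OF xr(1)]] I by (simp add: y_def)
    have y: "y \<in> cball p (r/2)" "y \<in> ball p r"
      using d(2)[of x] x r_pos by (auto simp: y_def \<rho>_def dist_commute)
    show "(\<psi> has_derivative \<psi>' x) (at x)" by (rule \<psi>_deriv[OF xr(1)])
    \<comment> \<open>At the foot \<open>tangent_eq\<close> reproduces \<open>X y\<close>, so this
      term drops out of the Lipschitz bound, whose right-hand side is a multiple of
      \<open>norm (x - y)\<close>, that is, of \<open>norm (\<psi> x)\<close>.\<close>
    have "\<psi>' y (X y) = 0"
      using tangent_eq[OF yM y(2) tang[OF yM]] by (simp add: \<psi>'_def)
    then show "norm (\<psi>' x (X x)) \<le> L * norm (\<psi> x)"
      using L[OF xr(2) y(1)] by (simp add: \<psi>_def y_def)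
    show "\<psi> x = 0 \<longleftrightarrow> x \<in> M"
      using yM c_\<tau>[OF _ xr(1)] by (auto simp: \<psi>_def y_def)
  qed
  moreover have "\<rho> > 0" using d(1) r_pos by (simp add: \<rho>_def)
  ultimately show ?thesis by blast
qed

text \<open>The semi-derivative is a definite description. Every flow witnessing a value leaves
  \<open>W - M\<close> fixed, so its difference quotient is constantly 0 and the value is 0; a value
  exists by assumption.\<close>

lemma eulerian_semideriv_tangential:
  fixes X :: "real^'n \<Rightarrow> real^'n"
  assumes X: "X \<in> C1c W" and M: "closed M" "smooth_submanifold 1 M"
    and tang: "\<And>x. x \<in> M \<Longrightarrow> X x \<in> tangent_space M x"
    and bdry: "\<And>x. x \<in> mfd_boundary 1 M \<Longrightarrow> X x = 0"
    and ex: "\<exists>L. has_eulerian_semideriv \<Xi> J (W - M) X L"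
  shows "eulerian_semideriv \<Xi> J (W - M) X = 0"
proof -
  have X_C1: "C1_map UNIV X" using X by (simp add: C1c_iff)
  obtain C where lip: "\<And>x y. norm (X x - X y) \<le> C * norm (x - y)"
    using C1c_lipschitz[OF X] by blast
  have zero: "X x = 0" if "x \<notin> W" for x
    using X that unfolding C1c_iff by blast
  have uniq: "L = 0" if L: "has_eulerian_semideriv \<Xi> J (W - M) X L" for L
  proof -
    obtain \<Phi> where \<Phi>: "is_flow X \<Phi>"
      and lim: "((\<lambda>t. (J (\<Phi> t ` (W - M)) - J (W - M)) / t) \<longlongrightarrow> L) (at_right 0)"
      using L unfolding has_eulerian_semideriv_def by blast
    have "\<Phi> t x \<in> M" if "x \<in> M" for x t
    proof (rule is_flow_preserves_closed[OF lip \<Phi> M(1) _ that])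
      fix p assume p: "p \<in> M"
      show "X p = 0 \<or> (\<exists>r>0. \<exists>C. \<exists>\<psi> :: real^'n \<Rightarrow> real^'n. \<exists>\<psi>'. \<forall>x\<in>ball p r. (\<psi> has_derivative \<psi>' x) (at x) \<and>
          norm (\<psi>' x (X x)) \<le> C * norm (\<psi> x) \<and> (\<psi> x = 0 \<longleftrightarrow> x \<in> M))"
      \<comment> \<open>Splitting on the boundary predicate yields an interior chart in the second
        case without having to show that no point is of both kinds.\<close>
      proof (cases "mfd_boundary_point 1 M p")
        case True
        then show ?thesis using bdry by (simp add: mfd_boundary_def)
      next
        case False
        then have "mfd_interior_point 1 M p" using M(2) p by (auto simp: smooth_submanifold_def)
        then obtain r \<delta> c c' \<tau> where "arc_chart M p r \<delta> c c' \<tau> UNIV" by (rule arc_chart_interior)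
        from arc_chart.tangential_field_displacement[OF this refl X_C1 tang] show ?thesis
          by (rule disjI2)
      qed
    qed
    from is_flow_image_diff[OF lip \<Phi> zero this] have "\<Phi> t ` (W - M) = W - M" for t .
    with lim have "((\<lambda>t. 0) \<longlongrightarrow> L) (at_right (0::real))" by simp
    then show ?thesis by (simp add: tendsto_const_iff)
  qed
  with ex show ?thesis unfolding eulerian_semideriv_def by (metis the_equality)
qed

section \<open>The \<open>C\<^sup>1\<close>-norm on a submanifold\<close>

lemma C1_extension_at:
  assumes "f \<in> C1 M" "p \<in> M"
  obtains U F where "open U" "p \<in> U" "C1_map U F" "\<And>x. x \<in> M \<Longrightarrow> x \<in> U \<Longrightarrow> F x = f x"
  using assms unfolding C1_def Ck_along_def Ck_on_1_iff by blast

lemma C1_diff: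
  assumes f: "f \<in> C1 M" and g: "g \<in> C1 M"
  shows "(\<lambda>x. f x - g x) \<in> C1 M"
  unfolding C1_def Ck_along_def Ck_on_1_iff mem_Collect_eq
proof
  fix p assume p: "p \<in> M"
  obtain U F where U: "open U" "p \<in> U" "C1_map U F" "\<And>x. x \<in> M \<Longrightarrow> x \<in> U \<Longrightarrow> F x = f x"
    using C1_extension_at[OF f p] by blast
  obtain V G where V: "open V" "p \<in> V" "C1_map V G" "\<And>x. x \<in> M \<Longrightarrow> x \<in> V \<Longrightarrow> G x = g x"
    using C1_extension_at[OF g p] by blast
  have "C1_map (U \<inter> V) (\<lambda>x. F x - G x)"
    using U(3) V(3) by (intro C1_map_diff) (auto elim: C1_map_subset)
  then show "\<exists>U F. open U \<and> p \<in> U \<and> C1_map U F \<and> (\<forall>x\<in>M \<inter> U. F x = f x - g x)"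
    using U V by (intro exI[of _ "U \<inter> V"] exI[of _ "\<lambda>x. F x - G x"]) auto
qed

lemma has_derivative_within_of_extension:
  assumes F: "C1_map U F" and U: "open U" and p: "p \<in> M" "p \<in> U"
    and eq: "\<And>x. x \<in> M \<Longrightarrow> x \<in> U \<Longrightarrow> F x = f x"
  shows "(f has_derivative frechet_derivative F (at p)) (at p within M)"
proof -
  obtain d where d: "d > 0" "ball p d \<subseteq> U" using U p(2) open_contains_ball by blast
  show ?thesis
  proof (rule has_derivative_transform_within[OF _ d(1) p(1)])
    show "(F has_derivative frechet_derivative F (at p)) (at p within M)"
      using C1_map_has_derivative[OF F p(2)] by (rule has_derivative_at_withinI)
    show "F x = f x" if "x \<in> M" "dist x p < d" for x
      using eq that d(2) by (auto simp: dist_commute)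
  qed
qed

text \<open>Along a curve in \<open>M\<close> either linear map gives the one-sided derivative of
  \<open>f (\<gamma> t)\<close>, which is unique; linearity carries the agreement to the span. The
  choice hidden in the derivative within \<open>M\<close> is thus harmless on tangent
  vectors.\<close>

lemma C1_tangential_derivative:
  fixes M :: "'a::euclidean_space set" and f :: "'a \<Rightarrow> real"
  assumes F: "C1_map U F" and U: "open U" and p: "p \<in> M" "p \<in> U"
    and eq: "\<And>x. x \<in> M \<Longrightarrow> x \<in> U \<Longrightarrow> F x = f x" and v: "v \<in> tangent_space M p"
  shows "frechet_derivative f (at p within M) v = frechet_derivative F (at p) v"
proof -
  let ?F' = "frechet_derivative F (at p)" and ?f' = "frechet_derivative f (at p within M)"
  have F': "(f has_derivative ?F') (at p within M)"
    by (rule has_derivative_within_of_extension[OF F U p eq])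
  then have f': "(f has_derivative ?f') (at p within M)"
    using frechet_derivative_works unfolding differentiable_def by blast
  have chain: "((\<lambda>t. f (\<gamma> t)) has_vector_derivative D w) (at 0 within {0..\<epsilon>})"
    if "(f has_derivative D) (at p within M)" "\<gamma> 0 = p" "\<gamma> ` {0..\<epsilon>} \<subseteq> M"
      "(\<gamma> has_vector_derivative w) (at (0::real) within {0..\<epsilon>})" for D \<gamma> \<epsilon> w
    using vector_derivative_diff_chain_within[OF that(4), of f D] has_derivative_subset[OF that(1,3)] that(2)
    by (simp add: o_def)
  have "?f' w = ?F' w" if w: "w \<in> inward_velocities M p" for w
  proof -
    obtain \<gamma> \<epsilon> where \<epsilon>: "\<epsilon> > 0" and \<gamma>: "\<gamma> 0 = p" "\<gamma> ` {0..\<epsilon>} \<subseteq> M"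
      "(\<gamma> has_vector_derivative w) (at (0::real) within {0..\<epsilon>})"
      using w unfolding inward_velocities_def by blast
    have "at (0::real) within {0..\<epsilon>} \<noteq> bot"
      using \<epsilon> by (simp add: trivial_limit_within islimpt_Icc)
    from vector_derivative_unique_within[OF this chain[OF f' \<gamma>] chain[OF F' \<gamma>]] show ?thesis .
  qed
  with v show ?thesis
    using linear_eq_on_span[OF has_derivative_linear[OF f'] has_derivative_linear[OF F']]
    unfolding tangent_space_def by blast
qed

text \<open>The sum of the absolute values of the bounds of a finite subcover dominates each of
  them.\<close>

lemma compact_locally_bounded:
  assumes M: "compact M"
    and loc: "\<And>p. p \<in> M \<Longrightarrow> \<exists>U B. open U \<and> p \<in> U \<and> (\<forall>x\<in>M \<inter> U. P x B)"
    and mono: "\<And>x B B'. P x B \<Longrightarrow> B \<le> B' \<Longrightarrow> P x B'"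
  shows "\<exists>B::real. \<forall>x\<in>M. P x B"
proof -
  obtain U B where UB: "\<And>p. p \<in> M \<Longrightarrow> open (U p)" "\<And>p. p \<in> M \<Longrightarrow> p \<in> U p"
    "\<And>p x. p \<in> M \<Longrightarrow> x \<in> M \<Longrightarrow> x \<in> U p \<Longrightarrow> P x (B p)"
    using loc by (metis IntI)
  obtain C where C: "C \<subseteq> M" "finite C" "M \<subseteq> \<Union> (U ` C)"
    using compactE_image[OF M, of M U] UB(1,2) by blast
  have "P x (\<Sum>p\<in>C. \<bar>B p\<bar>)" if x: "x \<in> M" for x
  proof -
    obtain p where p: "p \<in> C" "x \<in> U p" using C(3) x by blast
    have "\<bar>B p\<bar> \<le> (\<Sum>p\<in>C. \<bar>B p\<bar>)" by (rule member_le_sum) (use p C(2) in auto)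
    moreover have "P x (B p)" using UB(3) C(1) p x by blast
    ultimately show ?thesis using mono abs_ge_self[of "B p"] by (meson order_trans)
  qed
  then show ?thesis by blast
qed

text \<open>Real suprema are informative only over sets bounded above. Local extensions bound values
  and tangential derivatives near each point, compactness makes the bound uniform, and homogeneity
  passes from the unit ball to all tangent vectors.\<close>

lemma
  assumes M: "compact M" and f: "f \<in> C1 M" and p: "p \<in> M"
  shows C1_norm_ge_value: "\<bar>f p\<bar> \<le> C1_norm M f"
    and C1_norm_ge_derivative:
      "v \<in> tangent_space M p \<Longrightarrow> \<bar>frechet_derivative f (at p within M) v\<bar> \<le> C1_norm M f * norm v"
proof -
  let ?D = "\<lambda>p. frechet_derivative f (at p within M)"
  let ?T = "\<lambda>p. {v \<in> tangent_space M p. norm v \<le> 1}"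
  let ?S = "\<lambda>p. SUP v\<in>?T p. \<bar>?D p v\<bar>"
  have T0: "0 \<in> ?T p" for p by (simp add: tangent_space_def span_zero)
  have D_lin: "linear (?D p)" if q: "p \<in> M" for p
  proof -
    obtain U F where UF: "open U" "p \<in> U" "C1_map U F" "\<And>x. x \<in> M \<Longrightarrow> x \<in> U \<Longrightarrow> F x = f x"
      using C1_extension_at[OF f q] by blast
    have "(f has_derivative frechet_derivative F (at p)) (at p within M)"
      by (rule has_derivative_within_of_extension[OF UF(3,1) q UF(2,4)])
    then show ?thesis
      using frechet_derivative_works has_derivative_linear unfolding differentiable_def by blast
  qed
  have "\<exists>B. \<forall>x\<in>M. \<bar>f x\<bar> \<le> B \<and> (\<forall>v\<in>?T x. \<bar>?D x v\<bar> \<le> B)"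
  proof (rule compact_locally_bounded[OF M])
    fix p assume p: "p \<in> M"
    obtain U F where UF: "open U" "p \<in> U" "C1_map U F" "\<And>x. x \<in> M \<Longrightarrow> x \<in> U \<Longrightarrow> F x = f x"
      using C1_extension_at[OF f p] by blast
    obtain d where d: "d > 0" "cball p d \<subseteq> U" using UF(1,2) open_contains_cball by blast
    obtain B where B: "B \<ge> 0" "C1_bounded (cball p d) F B"
      by (rule C1_map_bounded[OF UF(3) compact_cball d(2)]) (rule that)
    have "\<bar>f x\<bar> \<le> B \<and> (\<forall>v\<in>?T x. \<bar>?D x v\<bar> \<le> B)" if x: "x \<in> M \<inter> ball p d" for x
    proof (intro conjI ballI)
      have x': "x \<in> M" "x \<in> U" "x \<in> cball p d" using x d(2) by auto
      show "\<bar>f x\<bar> \<le> B" using C1_boundedD(1)[OF B(2) x'(3)] UF(4)[OF x'(1,2)] by simp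
      fix v assume v: "v \<in> ?T x"
      have "\<bar>?D x v\<bar> = \<bar>frechet_derivative F (at x) v\<bar>"
        using C1_tangential_derivative[OF UF(3,1) x'(1,2) UF(4)] v by simp
      also have "\<dots> \<le> B * norm v" using C1_boundedD(2)[OF B(2) x'(3)] by simp
      also have "\<dots> \<le> B" using B(1) v by (simp add: mult_left_le)
      finally show "\<bar>?D x v\<bar> \<le> B" .
    qed
    then show "\<exists>U B. open U \<and> p \<in> U \<and> (\<forall>x\<in>M \<inter> U. \<bar>f x\<bar> \<le> B \<and> (\<forall>v\<in>?T x. \<bar>?D x v\<bar> \<le> B))"
      using d(1) by (intro exI[of _ "ball p d"] exI[of _ B]) simp
  qed force
  then obtain B where B: "\<And>x. x \<in> M \<Longrightarrow> \<bar>f x\<bar> \<le> B"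
    "\<And>x v. x \<in> M \<Longrightarrow> v \<in> ?T x \<Longrightarrow> \<bar>?D x v\<bar> \<le> B"
    by blast
  have bdd_T: "bdd_above ((\<lambda>v. \<bar>?D x v\<bar>) ` ?T x)" if "x \<in> M" for x
    using B(2)[OF that] by (intro bdd_aboveI2)
  have S_le: "?S x \<le> B" if "x \<in> M" for x
    using B(2)[OF that] T0[of x] by (intro cSUP_least) auto
  have value_le: "\<bar>f p\<bar> \<le> (SUP x\<in>M. \<bar>f x\<bar>)"
    using B(1) by (intro cSUP_upper p bdd_aboveI2)
  have S_ge: "?S p \<le> (SUP x\<in>M. ?S x)"
    by (intro cSUP_upper p bdd_aboveI2[of _ _ B] S_le)
  have D_ge: "\<bar>?D p v\<bar> \<le> (SUP x\<in>M. ?S x)" if "v \<in> ?T p" for v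
    using cSUP_upper[OF that bdd_T[OF p]] S_ge by simp
  have S_nonneg: "0 \<le> (SUP x\<in>M. ?S x)" using D_ge[OF T0] by linarith
  then show "\<bar>f p\<bar> \<le> C1_norm M f" using value_le by (simp add: C1_norm_def)
  have norm_ge: "(SUP x\<in>M. ?S x) \<le> C1_norm M f" using value_le by (simp add: C1_norm_def)
  assume v: "v \<in> tangent_space M p"
  show "\<bar>?D p v\<bar> \<le> C1_norm M f * norm v"
  proof (cases "v = 0")
    case True
    then show ?thesis using linear_0[OF D_lin[OF p]] by simp
  next
    case False
    have "v /\<^sub>R norm v \<in> ?T p"
      using v False by (simp add: tangent_space_def span_scale)
    then have "\<bar>?D p (v /\<^sub>R norm v)\<bar> \<le> C1_norm M f" using D_ge norm_ge by (meson order_trans)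
    moreover have "?D p (v /\<^sub>R norm v) = ?D p v / norm v"
      by (simp add: linear_scale[OF D_lin[OF p]] divide_inverse_commute)
    ultimately show ?thesis using False by (simp add: abs_divide divide_le_eq)
  qed
qed

text \<open>The derivative chosen for the zero function within \<open>M\<close> need not vanish in
  normal directions, but it does on tangent vectors. The value 0 is what places a function in the
  balls centred at it.\<close>

lemma C1_norm_const_zero:
  assumes "M \<noteq> {}"
  shows "C1_norm M (\<lambda>x. 0) = 0"
proof -
  have zero: "frechet_derivative (\<lambda>x. 0::real) (at p within M) v = 0"
    if "p \<in> M" "v \<in> tangent_space M p" for p v
    using C1_tangential_derivative[OF C1_map_const open_UNIV that(1), of 0 "\<lambda>x. 0" v] that(2) by simp
  have "(SUP v\<in>{v \<in> tangent_space M p. norm v \<le> 1}.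
      \<bar>frechet_derivative (\<lambda>x. 0::real) (at p within M) v\<bar>) = 0" if "p \<in> M" for p
  proof -
    have "0 \<in> {v \<in> tangent_space M p. norm v \<le> 1}" by (simp add: tangent_space_def span_zero)
    then have "{v \<in> tangent_space M p. norm v \<le> 1} \<noteq> {}" by blast
    moreover have "(SUP v\<in>{v \<in> tangent_space M p. norm v \<le> 1}.
        \<bar>frechet_derivative (\<lambda>x. 0::real) (at p within M) v\<bar>) =
        (SUP v\<in>{v \<in> tangent_space M p. norm v \<le> 1}. 0)"
      using zero that by (intro SUP_cong) auto
    ultimately show ?thesis by simp
  qed
  with assms show ?thesis by (simp add: C1_norm_def cong: SUP_cong_simp)
qed

text \<open>Reflection through the point \<open>(0, g 0)\<close> makes the derivative even, so that
  it continues the one-sided derivative at 0; an even reflection of \<open>g\<close> would in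
  general leave a kink.\<close>

lemma odd_reflection_has_derivative:
  fixes g d :: "real \<Rightarrow> real"
  assumes g: "\<And>s. 0 \<le> s \<Longrightarrow> s < \<delta> \<Longrightarrow> (g has_real_derivative d s) (at s within {0..<\<delta>})"
    and s: "\<bar>s\<bar> < \<delta>"
  shows "((\<lambda>s. if 0 \<le> s then g s else 2 * g 0 - g (- s)) has_real_derivative d \<bar>s\<bar>) (at s)"
    (is "(?h has_real_derivative _) _")
proof -
  have pos: "(g has_real_derivative d t) (at t)" if "0 < t" "t < \<delta>" for t
  proof -
    have "{0<..<\<delta>} \<subseteq> interior {0..<\<delta>}" by (rule interior_maximal) auto
    then have "at t within {0..<\<delta>} = at t" using that by (intro at_within_interior) auto
    then show ?thesis using g[OF less_imp_le] that by metis
  qed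
  consider "s < 0" | "s = 0" | "s > 0" by linarith
  then show ?thesis
  proof cases
    case 1
    have "(g has_real_derivative d \<bar>s\<bar>) (at (- s))" using pos[of "- s"] s 1 by simp
    then have "((\<lambda>s. 2 * g 0 - g (- s)) has_real_derivative d \<bar>s\<bar>) (at s)"
      by (auto intro!: derivative_eq_intros DERIV_chain2[where f = g])
    then show ?thesis
      by (rule has_field_derivative_transform_within_open[where S = "{..<0}"]) (use 1 in auto)
  next
    case 2
    have "((\<lambda>y. (g y - g 0) / (y - 0)) \<longlongrightarrow> d 0) (at 0 within {0..<\<delta>})"
      using g[of 0] s 2 by (simp add: has_field_derivative_iff)
    moreover have "filterlim abs (at 0 within {0..<\<delta>}) (at (0::real))"
      unfolding filterlim_at
    proof
      have "\<forall>\<^sub>F x in at (0::real). dist x 0 < \<delta>"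
        using s 2 eventually_at by (metis abs_zero)
      then show "\<forall>\<^sub>F x in at (0::real). \<bar>x\<bar> \<in> {0..<\<delta>} \<and> \<bar>x\<bar> \<noteq> 0"
        using eventually_neq_at_within[of 0 0 UNIV] by eventually_elim auto
      show "((\<lambda>x::real. \<bar>x\<bar>) \<longlongrightarrow> 0) (at 0)" by (rule tendsto_eq_intros | simp)+
    qed
    ultimately have "((\<lambda>y. (g \<bar>y\<bar> - g 0) / (\<bar>y\<bar> - 0)) \<longlongrightarrow> d 0) (at 0)"
      by (rule filterlim_compose)
    \<comment> \<open>On both sides of 0 the difference quotient of the reflected function at
      \<open>y\<close> is that of \<open>g\<close> at \<open>\<bar>y\<bar>\<close>.\<close>
    moreover have "\<forall>\<^sub>F y in at 0. (g \<bar>y\<bar> - g 0) / (\<bar>y\<bar> - 0) = (?h y - ?h 0) / (y - 0)"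
      using eventually_neq_at_within[of 0 0 UNIV]
      by eventually_elim (auto simp: field_simps)
    ultimately have "((\<lambda>y. (?h y - ?h 0) / (y - 0)) \<longlongrightarrow> d 0) (at 0)"
      by (rule Lim_transform_eventually)
    then show ?thesis using 2 by (simp add: has_field_derivative_iff)
  next
    case 3
    have "(g has_real_derivative d \<bar>s\<bar>) (at s)" using pos[of s] s 3 by simp
    then show ?thesis
      by (rule has_field_derivative_transform_within_open[where S = "{0<..}"]) (use 3 in auto)
  qed
qed

section \<open>Extending a function off the submanifold within a chart\<close>

context arc_chart
begin

text \<open>For parameters in \<open>I\<close> this is the derivative of \<open>f (c s)\<close>,
  written through the derivative within \<open>M\<close> so that \<open>C1_norm\<close> bounds it
  directly.\<close>

definition param_derivative :: "('a \<Rightarrow> real) \<Rightarrow> real \<Rightarrow> real" where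
  "param_derivative f s = frechet_derivative f (at (c s) within M) (c' s)"

text \<open>A local extension of \<open>f\<close> composed with \<open>c\<close> is C^1 on an open
  set of parameters, including some outside \<open>I\<close> at an end point. On \<open>I\<close>
  its derivative depends on \<open>f\<close> alone, because the velocity is tangent.\<close>

lemma param_local:
  assumes f: "f \<in> C1 M" and s: "s \<in> I" "\<bar>s\<bar> < \<delta>"
  obtains V G e where "open V" "s \<in> V" "\<And>t. t \<in> V \<Longrightarrow> (G has_real_derivative e t) (at t)"
    "continuous_on V e" "\<And>t. t \<in> V \<Longrightarrow> t \<in> I \<Longrightarrow> \<bar>t\<bar> < \<delta> \<Longrightarrow> G t = f (c t) \<and> e t = param_derivative f t"
proof -
  obtain U F where F: "open U" "c s \<in> U" "C1_map U F" "\<And>x. x \<in> M \<Longrightarrow> x \<in> U \<Longrightarrow> F x = f x"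
    using C1_extension_at[OF f c_in[OF s(2,1)]] by blast
  define V where "V = {-\<delta><..<\<delta>} \<inter> c -` U"
  define e where "e t = frechet_derivative F (at (c t)) (c' t)" for t
  have V_sub: "V \<subseteq> {-\<delta><..<\<delta>}" and cV: "c ` V \<subseteq> U" by (auto simp: V_def)
  show thesis
  proof
    show "open V"
      unfolding V_def by (rule continuous_open_preimage[OF C1_map_continuous_on[OF c_C1] _ F(1)]) simp
    show "s \<in> V" using s F(2) by (auto simp: V_def abs_less_iff)
    show "((\<lambda>t. F (c t)) has_real_derivative e t) (at t)" if "t \<in> V" for t
    proof -
      have "\<bar>t\<bar> < \<delta>" "c t \<in> U" using that by (auto simp: V_def)
      then show ?thesis
        using has_vector_derivative_chain_C1_map[OF F(3) _ c_deriv]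
        by (simp add: e_def has_real_derivative_iff_has_vector_derivative)
    qed
    show "continuous_on V e"
      unfolding e_def[abs_def] using cV
      by (intro C1_map_continuous_derivative_compose[OF F(3)] continuous_on_subset[OF _ V_sub]
          C1_map_continuous_on c_C1 c'_C1)
    show "F (c t) = f (c t) \<and> e t = param_derivative f t" if t: "t \<in> V" "t \<in> I" "\<bar>t\<bar> < \<delta>" for t
      using C1_tangential_derivative[OF F(3,1) c_in[OF t(3,2)] _ F(4) velocity_in_tangent_space[OF t(3,2)]]
        F(4)[OF c_in[OF t(3,2)]] cV t(1)
      by (auto simp: e_def param_derivative_def)
  qed
qed

lemma param_has_derivative:
  assumes f: "f \<in> C1 M" and s: "s \<in> I" "\<bar>s\<bar> < \<delta>"
  shows "((\<lambda>s. f (c s)) has_real_derivative param_derivative f s) (at s within I \<inter> {-\<delta><..<\<delta>})"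
proof -
  obtain V G e where V: "open V" "s \<in> V" "\<And>t. t \<in> V \<Longrightarrow> (G has_real_derivative e t) (at t)"
    "continuous_on V e" "\<And>t. t \<in> V \<Longrightarrow> t \<in> I \<Longrightarrow> \<bar>t\<bar> < \<delta> \<Longrightarrow> G t = f (c t) \<and> e t = param_derivative f t"
    using param_local[OF assms] by blast
  obtain d where d: "d > 0" "ball s d \<subseteq> V" using V(1,2) open_contains_ball by blast
  have "(G has_real_derivative param_derivative f s) (at s within I \<inter> {-\<delta><..<\<delta>})"
    using V(3)[OF V(2)] V(5)[OF V(2) s] by (simp add: has_field_derivative_at_within)
  then show ?thesis
  proof (rule has_field_derivative_transform_within[OF _ d(1)])
    show "s \<in> I \<inter> {-\<delta><..<\<delta>}" using s by auto
    show "G t = f (c t)" if "t \<in> I \<inter> {-\<delta><..<\<delta>}" "dist t s < d" for t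
      using V(5)[of t] d(2) that by (auto simp: dist_commute subset_eq)
  qed
qed

lemma param_derivative_continuous:
  assumes f: "f \<in> C1 M"
  shows "continuous_on (I \<inter> {-\<delta><..<\<delta>}) (param_derivative f)"
proof -
  have "continuous (at s within I \<inter> {-\<delta><..<\<delta>}) (param_derivative f)" if "s \<in> I \<inter> {-\<delta><..<\<delta>}" for s
  proof -
    have s: "s \<in> I" "\<bar>s\<bar> < \<delta>" using that by auto
    obtain V G e where V: "open V" "s \<in> V" "\<And>t. t \<in> V \<Longrightarrow> (G has_real_derivative e t) (at t)"
      "continuous_on V e" "\<And>t. t \<in> V \<Longrightarrow> t \<in> I \<Longrightarrow> \<bar>t\<bar> < \<delta> \<Longrightarrow> G t = f (c t) \<and> e t = param_derivative f t"
      using param_local[OF f s] by blast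
    obtain d where d: "d > 0" "ball s d \<subseteq> V" using V(1,2) open_contains_ball by blast
    have "isCont e s" using V(1,2,4) by (simp add: continuous_on_eq_continuous_at)
    then have "continuous (at s within I \<inter> {-\<delta><..<\<delta>}) e"
      by (rule continuous_at_imp_continuous_at_within)
    then show ?thesis
    proof (rule continuous_transform_within[OF _ d(1) that])
      show "e t = param_derivative f t" if "t \<in> I \<inter> {-\<delta><..<\<delta>}" "dist t s < d" for t
        using V(5)[of t] d(2) that by (auto simp: dist_commute subset_eq)
    qed
  qed
  then show ?thesis by (simp add: continuous_on_eq_continuous_within)
qed

lemma param_derivative_le:
  assumes "compact M" "f \<in> C1 M" "s \<in> I" "\<bar>s\<bar> < \<delta>"
  shows "\<bar>param_derivative f s\<bar> \<le> C1_norm M f * norm (c' s)"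
  unfolding param_derivative_def
  by (rule C1_norm_ge_derivative) (use assms c_in velocity_in_tangent_space in auto)

text \<open>At a boundary point the values at parameters outside \<open>I\<close> are obtained by odd reflection.\<close>

lemma param_extension:
  assumes M: "compact M" and f: "f \<in> C1 M"
  obtains g g' where "\<And>s. \<bar>s\<bar> < \<delta> \<Longrightarrow> (g has_real_derivative g' s) (at s)"
    "continuous_on {-\<delta><..<\<delta>} g'" "\<And>s. s \<in> I \<Longrightarrow> \<bar>s\<bar> < \<delta> \<Longrightarrow> g s = f (c s)"
    "\<And>s. \<bar>s\<bar> < \<delta> \<Longrightarrow> \<bar>g s\<bar> \<le> 3 * C1_norm M f"
    "\<And>s. \<bar>s\<bar> < \<delta> \<Longrightarrow> \<exists>u. \<bar>u\<bar> = \<bar>s\<bar> \<and> \<bar>g' s\<bar> \<le> C1_norm M f * norm (c' u)"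
proof -
  let ?d = "param_derivative f"
  have f_le: "\<bar>f (c s)\<bar> \<le> C1_norm M f" if "s \<in> I" "\<bar>s\<bar> < \<delta>" for s
    by (rule C1_norm_ge_value[OF M f c_in[OF that(2,1)]])
  show thesis
  proof (cases "I = UNIV")
    case True
    show thesis
    proof (rule that[of "\<lambda>s. f (c s)" ?d])
      show "((\<lambda>s. f (c s)) has_real_derivative ?d s) (at s)" if "\<bar>s\<bar> < \<delta>" for s
      proof -
        have "at s within {-\<delta><..<\<delta>} = at s" using that by (intro at_within_open) auto
        then show ?thesis using param_has_derivative[OF f _ that] True by simp
      qed
      show "continuous_on {-\<delta><..<\<delta>} ?d"
        using param_derivative_continuous[OF f] True by simp
      show "\<bar>f (c s)\<bar> \<le> 3 * C1_norm M f" if "\<bar>s\<bar> < \<delta>" for s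
        using f_le[of s] that True by simp
      show "\<exists>u. \<bar>u\<bar> = \<bar>s\<bar> \<and> \<bar>?d s\<bar> \<le> C1_norm M f * norm (c' u)" if "\<bar>s\<bar> < \<delta>" for s
        using param_derivative_le[OF M f _ that] True by blast
    qed simp
  next
    case False
    then have I: "I = {0..}" using I_cases by blast
    then have I\<delta>: "I \<inter> {-\<delta><..<\<delta>} = {0..<\<delta>}" using \<delta>_pos by auto
    define g where "g s = (if 0 \<le> s then f (c s) else 2 * f (c 0) - f (c (- s)))" for s
    show thesis
    proof (rule that[of g "\<lambda>s. ?d \<bar>s\<bar>"])
      show "(g has_real_derivative ?d \<bar>s\<bar>) (at s)" if "\<bar>s\<bar> < \<delta>" for s
        unfolding g_def[abs_def]
      proof (rule odd_reflection_has_derivative[OF _ that])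
        show "((\<lambda>s. f (c s)) has_real_derivative ?d s) (at s within {0..<\<delta>})"
          if "0 \<le> s" "s < \<delta>" for s
          using param_has_derivative[OF f, of s] that I I\<delta> by simp
      qed
      show "continuous_on {-\<delta><..<\<delta>} (\<lambda>s. ?d \<bar>s\<bar>)"
        using param_derivative_continuous[OF f] unfolding I\<delta>
        by (rule continuous_on_compose2) (auto intro!: continuous_intros)
      show "g s = f (c s)" if "s \<in> I" for s using that I by (simp add: g_def)
      \<comment> \<open>The reflected value \<open>2 * f (c 0) - f (c (- s))\<close> is the source
        of the factor 3.\<close>
      show "\<bar>g s\<bar> \<le> 3 * C1_norm M f" if "\<bar>s\<bar> < \<delta>" for s
        using f_le[of s] f_le[of "- s"] f_le[of 0] that \<delta>_pos I by (auto simp: g_def)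
      show "\<exists>u. \<bar>u\<bar> = \<bar>s\<bar> \<and> \<bar>?d \<bar>s\<bar>\<bar> \<le> C1_norm M f * norm (c' u)" if "\<bar>s\<bar> < \<delta>" for s
        using param_derivative_le[OF M f, of "\<bar>s\<bar>"] that I by (intro exI[of _ "\<bar>s\<bar>"]) simp
    qed
  qed
qed

text \<open>The extension \<open>g (\<tau> x)\<close> is constant on level sets of \<tau>, so its
  derivative involves \<open>f\<close> only along \<open>M\<close>. In \<open>3 + A * B\<close> the
  3 stems from the reflection, \<open>A\<close> bounds the velocity and \<open>B\<close> the
  derivative of \<tau>; none depends on \<open>f\<close>.\<close>

lemma ambient_extension:
  assumes M: "compact M"
  obtains C where "C \<ge> 0" "\<And>f. f \<in> C1 M \<Longrightarrow> \<exists>F. C1_bounded (ball p (r/2)) F (C * C1_norm M f) \<and>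
    (\<forall>x\<in>M \<inter> ball p (r/2). F x = f x)"
proof -
  let ?K = "cball p (r/2)"
  have K: "?K \<subseteq> ball p r" using r_pos by (auto simp: subset_eq)
  have "continuous_on ?K (\<lambda>x. \<bar>\<tau> x\<bar>)"
    using continuous_on_subset[OF C1_map_continuous_on[OF \<tau>_C1] K] by (intro continuous_intros)
  moreover have "?K \<noteq> {}" using r_pos by simp
  \<comment> \<open>The maximum at \<open>y\<close> confines all parameters to a compact interval
    inside the chart domain. The interval is symmetric because the derivative of a reflected
    function is estimated at a parameter \<open>u\<close> known up to sign.\<close>
  ultimately obtain y where y: "y \<in> ?K" "\<And>x. x \<in> ?K \<Longrightarrow> \<bar>\<tau> x\<bar> \<le> \<bar>\<tau> y\<bar>"
    using continuous_attains_sup[OF compact_cball] by blast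
  have y\<delta>: "\<bar>\<tau> y\<bar> < \<delta>" using \<tau>_less y(1) K by blast
  have sub: "{-\<bar>\<tau> y\<bar>..\<bar>\<tau> y\<bar>} \<subseteq> {-\<delta><..<\<delta>}" using y\<delta> by auto
  obtain A where A: "A \<ge> 0" "C1_bounded {-\<bar>\<tau> y\<bar>..\<bar>\<tau> y\<bar>} c' A"
    by (rule C1_map_bounded[OF c'_C1 compact_Icc sub]) (rule that)
  obtain B where B: "B \<ge> 0" "C1_bounded ?K \<tau> B"
    by (rule C1_map_bounded[OF \<tau>_C1 compact_cball K]) (rule that)
  show thesis
  proof
    show "0 \<le> 3 + A * B" using A(1) B(1) by simp
    fix f assume f: "f \<in> C1 M"
    obtain g g' where g: "\<And>s. \<bar>s\<bar> < \<delta> \<Longrightarrow> (g has_real_derivative g' s) (at s)"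
      and g'_cont: "continuous_on {-\<delta><..<\<delta>} g'" and g_eq: "\<And>s. s \<in> I \<Longrightarrow> \<bar>s\<bar> < \<delta> \<Longrightarrow> g s = f (c s)"
      and g_le: "\<And>s. \<bar>s\<bar> < \<delta> \<Longrightarrow> \<bar>g s\<bar> \<le> 3 * C1_norm M f"
      and g'_le: "\<And>s. \<bar>s\<bar> < \<delta> \<Longrightarrow> \<exists>u. \<bar>u\<bar> = \<bar>s\<bar> \<and> \<bar>g' s\<bar> \<le> C1_norm M f * norm (c' u)"
      by (rule param_extension[OF M f]) (rule that)
    have N: "C1_norm M f \<ge> 0" using C1_norm_ge_value[OF M f p_in] by linarith
    have g_C1: "C1_map {-\<delta><..<\<delta>} g"
      by (rule C1_map_real[OF g g'_cont]) auto
    have ball_sub: "ball p (r/2) \<subseteq> ball p r" using r_pos by auto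
    have "C1_bounded (ball p (r/2)) (\<lambda>x. g (\<tau> x)) ((3 + A * B) * C1_norm M f)"
    proof (rule C1_boundedI)
      show "C1_map (ball p (r/2)) (\<lambda>x. g (\<tau> x))"
        by (rule C1_map_compose[OF g_C1 C1_map_subset[OF \<tau>_C1 ball_sub]]) (use \<tau>_maps ball_sub in blast)
      fix x assume x: "x \<in> ball p (r/2)"
      have \<tau>x: "\<bar>\<tau> x\<bar> < \<delta>" using \<tau>_less x ball_sub by blast
      have xK: "x \<in> ?K" using x by simp
      have "3 * C1_norm M f \<le> (3 + A * B) * C1_norm M f"
        using N A(1) B(1) by (intro mult_right_mono) auto
      then show "norm (g (\<tau> x)) \<le> (3 + A * B) * C1_norm M f" using g_le[OF \<tau>x] by simp
      have "(\<tau> has_derivative frechet_derivative \<tau> (at x)) (at x)"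
        using C1_map_has_derivative[OF \<tau>_C1] x ball_sub by blast
      from diff_chain_at[OF this g[OF \<tau>x, unfolded has_field_derivative_def]]
      show "((\<lambda>x. g (\<tau> x)) has_derivative (\<lambda>v. g' (\<tau> x) * frechet_derivative \<tau> (at x) v)) (at x)"
        by (simp add: o_def)
      fix v
      obtain u where u: "\<bar>u\<bar> = \<bar>\<tau> x\<bar>" "\<bar>g' (\<tau> x)\<bar> \<le> C1_norm M f * norm (c' u)"
        using g'_le[OF \<tau>x] by blast
      have "u \<in> {-\<bar>\<tau> y\<bar>..\<bar>\<tau> y\<bar>}" using y(2)[OF xK] u(1) by auto
      then have "norm (c' u) \<le> A" using C1_boundedD(1)[OF A(2)] by blast
      then have "\<bar>g' (\<tau> x)\<bar> \<le> C1_norm M f * A"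
        using u(2) mult_left_mono[OF _ N] by (meson order_trans)
      then have "\<bar>g' (\<tau> x)\<bar> * \<bar>frechet_derivative \<tau> (at x) v\<bar> \<le> (C1_norm M f * A) * (B * norm v)"
        using C1_boundedD(2)[OF B(2) xK, of v] N A(1) by (intro mult_mono) auto
      also have "\<dots> \<le> (3 + A * B) * C1_norm M f * norm v"
        using N by (simp add: algebra_simps)
      finally show "norm (g' (\<tau> x) * frechet_derivative \<tau> (at x) v)
          \<le> (3 + A * B) * C1_norm M f * norm v"
        by (simp add: abs_mult)
    qed
    moreover have "g (\<tau> x) = f x" if "x \<in> M \<inter> ball p (r/2)" for x
    proof -
      have x: "x \<in> M" "x \<in> ball p r" using that ball_sub by auto
      show ?thesis using g_eq[OF \<tau>_in[OF x] \<tau>_less[OF x(2)]] c_\<tau>[OF x] by simp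
    qed
    ultimately show "\<exists>F. C1_bounded (ball p (r/2)) F ((3 + A * B) * C1_norm M f) \<and>
        (\<forall>x\<in>M \<inter> ball p (r/2). F x = f x)"
      by blast
  qed
qed

end

section \<open>Extension of normal fields, and the function space topologies\<close>

lemma C1_bounded_mono: "C1_bounded U f B \<Longrightarrow> B \<le> C \<Longrightarrow> C1_bounded U f C"
  unfolding C1_bounded_def by (meson mult_right_mono norm_ge_zero order_trans)

lemma C1_bounded_uminus:
  assumes f: "C1_bounded U f B"
  shows "C1_bounded U (\<lambda>x. - f x) B"
proof (rule C1_boundedI)
  have f1: "C1_map U f" using f by (simp add: C1_bounded_def)
  show "C1_map U (\<lambda>x. - f x)"
    using C1_map_diff[OF C1_map_const f1, of 0] by simp
  show "((\<lambda>x. - f x) has_derivative (\<lambda>v. - frechet_derivative f (at x) v)) (at x)" if "x \<in> U" for x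
    using C1_map_has_derivative[OF f1 that] by (rule has_derivative_minus)
qed (use C1_boundedD[OF f] in auto)

lemma C1_norm_nonneg: "compact M \<Longrightarrow> M \<noteq> {} \<Longrightarrow> f \<in> C1 M \<Longrightarrow> 0 \<le> C1_norm M f"
  using C1_norm_ge_value by (metis abs_ge_zero all_not_in_conv order_trans)

text \<open>The extension of \<open>f\<close> is multiplied by a local smooth extension of
  \<open>n\<close>. Radius and constant precede \<open>f\<close>, which is what the gluing over a
  finite cover relies on.\<close>

lemma local_field_extension:
  fixes M W :: "'a::euclidean_space set" and n :: "'a \<Rightarrow> 'b::euclidean_space"
  assumes M: "compact M" "smooth_submanifold 1 M" and W: "open W" "M \<subseteq> W"
    and n: "Ck_along \<infinity> M n" and p: "p \<in> M"
  shows "\<exists>R>0. \<exists>C\<ge>0. cball p R \<subseteq> W \<and> (\<forall>f\<in>C1 M. \<exists>Y. C1_bounded (ball p R) Y (C * C1_norm M f) \<and>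
    (\<forall>x\<in>M \<inter> ball p R. Y x = f x *\<^sub>R n x))"
proof -
  obtain r \<delta> c c' \<tau> I where arc: "arc_chart M p r \<delta> c c' \<tau> I"
    by (rule arc_chart_at[OF M(2) p]) (rule that)
  obtain C where C: "C \<ge> 0" "\<And>f. f \<in> C1 M \<Longrightarrow> \<exists>F. C1_bounded (ball p (r/2)) F (C * C1_norm M f) \<and>
      (\<forall>x\<in>M \<inter> ball p (r/2). F x = f x)"
    by (rule arc_chart.ambient_extension[OF arc M(1)]) (rule that)
  obtain U G where G: "open U" "p \<in> U" "Ck_on \<infinity> U G" "\<forall>x\<in>M \<inter> U. G x = n x"
    using n p unfolding Ck_along_def by blast
  have "open (U \<inter> W)" "p \<in> U \<inter> W" using G W p by auto
  then obtain d where d: "d > 0" "cball p d \<subseteq> U \<inter> W" using open_contains_cball by blast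
  have dU: "cball p d \<subseteq> U" using d(2) by blast
  obtain B where B: "B \<ge> 0" "C1_bounded (cball p d) G B"
    by (rule C1_map_bounded[OF C1_map_of_smooth(1)[OF G(3)] compact_cball dU]) (rule that)
  define R where "R = min d (r/2)"
  have R: "ball p R \<subseteq> cball p d" "ball p R \<subseteq> ball p (r/2)" "cball p R \<subseteq> cball p d"
    by (auto simp: R_def)
  have "\<exists>Y. C1_bounded (ball p R) Y (2 * C * B * C1_norm M f) \<and> (\<forall>x\<in>M \<inter> ball p R. Y x = f x *\<^sub>R n x)"
    if f: "f \<in> C1 M" for f
  proof -
    have "M \<noteq> {}" using p by blast
    then have N: "0 \<le> C * C1_norm M f" using C1_norm_nonneg[OF M(1) _ f] C(1) by simp
    obtain F where F: "C1_bounded (ball p (r/2)) F (C * C1_norm M f)" "\<forall>x\<in>M \<inter> ball p (r/2). F x = f x"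
      using C(2)[OF f] by blast
    have "C1_bounded (ball p R) (\<lambda>x. F x *\<^sub>R G x) (2 * (C * C1_norm M f) * B)"
      by (rule C1_bounded_scaleR[OF C1_bounded_subset[OF F(1) R(2)] C1_bounded_subset[OF B(2) R(1)] N B(1)])
    moreover have "F x *\<^sub>R G x = f x *\<^sub>R n x" if "x \<in> M \<inter> ball p R" for x
    proof -
      have "x \<in> M \<inter> ball p (r/2)" "x \<in> M \<inter> U" using that R(1,2) dU by blast+
      then show ?thesis using F(2) G(4) by simp
    qed
    ultimately show ?thesis
      by (intro exI[of _ "\<lambda>x. F x *\<^sub>R G x"]) (simp add: mult.assoc mult.left_commute mult.commute)
  qed
  moreover have "R > 0" using d(1) arc_chart.r_pos[OF arc] by (simp add: R_def)
  moreover have "0 \<le> 2 * C * B" using C(1) B(1) by simp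
  moreover have "cball p R \<subseteq> W" using R(3) d(2) by blast
  ultimately show ?thesis by blast
qed

text \<open>A finite cover is treated one ball at a time, in place of a partition of unity:
  \<open>X\<close> is replaced by \<open>X x + \<eta> x *\<^sub>R (Y x - X x)\<close>, where
  \<open>Y\<close> is the local extension on the new ball. Where \<eta> is 1 the result is
  \<open>Y\<close>, and at points of \<open>M\<close> already treated the correction is 0.\<close>

lemma field_extension:
  fixes M W :: "(real^'n) set" and n :: "real^'n \<Rightarrow> real^'n"
  assumes M: "compact M" "M \<noteq> {}" "smooth_submanifold 1 M" and W: "open W" "M \<subseteq> W"
    and n: "Ck_along \<infinity> M n"
  obtains C where "C \<ge> 0" "\<And>f. f \<in> C1 M \<Longrightarrow>
    \<exists>X\<in>C1c W. C1_bounded UNIV X (C * C1_norm M f) \<and> (\<forall>x\<in>M. X x = f x *\<^sub>R n x)"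
proof -
  define P where "P p R C \<longleftrightarrow> R > 0 \<and> C \<ge> 0 \<and> cball p R \<subseteq> W \<and>
      (\<forall>f\<in>C1 M. \<exists>Y. C1_bounded (ball p R) Y (C * C1_norm M f) \<and> (\<forall>x\<in>M \<inter> ball p R. Y x = f x *\<^sub>R n x))"
    for p R C
  have "\<exists>R C. P p R C" if "p \<in> M" for p
    using local_field_extension[OF M(1,3) W n that] unfolding P_def by blast
  then obtain R L where "\<And>p. p \<in> M \<Longrightarrow> P p (R p) (L p)" by metis
  then have RL: "\<forall>p\<in>M. R p > 0 \<and> L p \<ge> 0 \<and> cball p (R p) \<subseteq> W \<and>
      (\<forall>f\<in>C1 M. \<exists>Y. C1_bounded (ball p (R p)) Y (L p * C1_norm M f) \<and>
        (\<forall>x\<in>M \<inter> ball p (R p). Y x = f x *\<^sub>R n x))"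
    by (simp add: P_def)
  \<comment> \<open>The radius \<open>R q / 4\<close> is where a cutoff supported in
    \<open>cball q (R q / 2)\<close> is guaranteed to be 1.\<close>
  have glue: "\<exists>C\<ge>0. \<forall>f\<in>C1 M. \<exists>X\<in>C1c W. C1_bounded UNIV X (C * C1_norm M f) \<and>
      (\<forall>q\<in>Q. \<forall>x\<in>M \<inter> ball q (R q / 4). X x = f x *\<^sub>R n x)" if "finite Q" "Q \<subseteq> M" for Q
    using that
  proof (induction Q rule: finite_induct)
    case empty
    have "C1_bounded UNIV (\<lambda>x::real^'n. 0::real^'n) (0 * C1_norm M f)" for f
      by (rule C1_boundedI[where f' = "\<lambda>_ _. 0"]) (auto simp: C1_map_const)
    then show ?case using C1c_zero by (intro exI[of _ 0]) auto
  next
    case (insert q Q)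
    then obtain C where C: "C \<ge> 0" "\<forall>f\<in>C1 M. \<exists>X\<in>C1c W. C1_bounded UNIV X (C * C1_norm M f) \<and>
        (\<forall>q\<in>Q. \<forall>x\<in>M \<inter> ball q (R q / 4). X x = f x *\<^sub>R n x)"
      by blast
    have q: "R q > 0" "L q \<ge> 0" "cball q (R q) \<subseteq> W" using RL insert.prems by auto
    obtain \<eta> :: "real^'n \<Rightarrow> real" and B where B: "B \<ge> 0" "C1_bounded UNIV \<eta> B"
      and \<eta>1: "\<And>x. x \<in> ball q (R q / 2 / 2) \<Longrightarrow> \<eta> x = 1"
      and \<eta>0: "\<And>x. x \<notin> cball q (R q / 2) \<Longrightarrow> \<eta> x = 0"
      by (rule C1_cutoff[of "R q / 2" q]) (use q in auto)
    have "\<exists>X\<in>C1c W. C1_bounded UNIV X ((C + 2 * B * (L q + C)) * C1_norm M f) \<and>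
        (\<forall>q\<in>insert q Q. \<forall>x\<in>M \<inter> ball q (R q / 4). X x = f x *\<^sub>R n x)" if f: "f \<in> C1 M" for f
    proof -
      define N where "N = C1_norm M f"
      have N: "N \<ge> 0" using C1_norm_nonneg[OF M(1,2) f] by (simp add: N_def)
      obtain X where X: "X \<in> C1c W" "C1_bounded UNIV X (C * N)"
        "\<And>q x. q \<in> Q \<Longrightarrow> x \<in> M \<inter> ball q (R q / 4) \<Longrightarrow> X x = f x *\<^sub>R n x"
        using C(2) f unfolding N_def by blast
      obtain Y where Y: "C1_bounded (ball q (R q)) Y (L q * N)"
        "\<And>x. x \<in> M \<inter> ball q (R q) \<Longrightarrow> Y x = f x *\<^sub>R n x"
        using RL insert.prems f unfolding N_def by blast
      define Z where "Z x = \<eta> x *\<^sub>R (Y x + - X x)" for x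
      have sub: "cball q (R q / 2) \<subseteq> ball q (R q)" using q(1) by (auto simp: subset_eq)
      have nonneg: "0 \<le> L q * N + C * N" using q(2) C(1) N by simp
      have "C1_bounded (ball q (R q)) Z (2 * B * (L q * N + C * N))"
        unfolding Z_def[abs_def] using B X(2)
        by (intro C1_bounded_scaleR C1_bounded_add C1_bounded_uminus Y(1) nonneg)
          (auto elim: C1_bounded_subset)
      then have Z: "C1_bounded UNIV Z (2 * B * (L q * N + C * N))"
        by (rule C1_bounded_extend_zero[OF _ _ open_ball closed_cball sub])
          (use nonneg B(1) \<eta>0 in \<open>auto simp: Z_def\<close>)
      have "Z \<in> C1c W"
        unfolding C1c_iff
      proof (intro conjI exI[of _ "cball q (R q / 2)"])
        show "C1_map UNIV Z" using Z by (simp add: C1_bounded_def)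
        show "cball q (R q / 2) \<subseteq> W" using sub q(3) ball_subset_cball by blast
      qed (use \<eta>0 in \<open>auto simp: Z_def\<close>)
      then have "(\<lambda>x. X x + Z x) \<in> C1c W" by (rule C1c_add[OF X(1)])
      moreover have "C1_bounded UNIV (\<lambda>x. X x + Z x) ((C + 2 * B * (L q + C)) * N)"
        using C1_bounded_add[OF X(2) Z] by (simp add: algebra_simps)
      moreover have "X x + Z x = f x *\<^sub>R n x" if q': "q' \<in> insert q Q" and x: "x \<in> M \<inter> ball q' (R q' / 4)" for q' x
      proof (cases "q' \<in> Q")
        case True
        then have "X x = f x *\<^sub>R n x" using X(3) x by blast
        \<comment> \<open>Off the support of \<eta> nothing changes; on it \<open>X\<close> and
          \<open>Y\<close> have the same prescribed value.\<close>
        moreover have "\<eta> x = 0 \<or> Y x = f x *\<^sub>R n x"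
          using \<eta>0[of x] Y(2)[of x] sub x by blast
        ultimately show ?thesis by (auto simp: Z_def)
      next
        case False
        then have "x \<in> M \<inter> ball q (R q / 4)" using q' x by blast
        then have "\<eta> x = 1" "x \<in> M \<inter> ball q (R q)" using \<eta>1[of x] q(1) by auto
        then show ?thesis using Y(2) by (simp add: Z_def)
      qed
      ultimately show ?thesis unfolding N_def by blast
    qed
    moreover have "0 \<le> C + 2 * B * (L q + C)" using C(1) B(1) q(2) by simp
    ultimately show ?case by blast
  qed
  have "M \<subseteq> (\<Union>q\<in>M. ball q (R q / 4))" using RL by force
  then obtain Q where Q: "Q \<subseteq> M" "finite Q" "M \<subseteq> (\<Union>q\<in>Q. ball q (R q / 4))"
    using compactE_image[OF M(1), of M "\<lambda>q. ball q (R q / 4)"] by blast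
  from glue[OF Q(2,1)] obtain C where C: "C \<ge> 0" "\<forall>f\<in>C1 M. \<exists>X\<in>C1c W.
      C1_bounded UNIV X (C * C1_norm M f) \<and> (\<forall>q\<in>Q. \<forall>x\<in>M \<inter> ball q (R q / 4). X x = f x *\<^sub>R n x)"
    by blast
  have "\<exists>X\<in>C1c W. C1_bounded UNIV X (C * C1_norm M f) \<and> (\<forall>x\<in>M. X x = f x *\<^sub>R n x)" if f: "f \<in> C1 M" for f
  proof -
    obtain X where "X \<in> C1c W" "C1_bounded UNIV X (C * C1_norm M f)"
      and X: "\<forall>q\<in>Q. \<forall>x\<in>M \<inter> ball q (R q / 4). X x = f x *\<^sub>R n x"
      using C(2) f by blast
    moreover have "\<forall>x\<in>M. X x = f x *\<^sub>R n x" using X Q(3) by blast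
    ultimately show ?thesis by blast
  qed
  with C(1) show thesis by (rule that)
qed

section \<open>Global C^1 bounds and the seminorm topologies\<close>

lemma SUP_norm_le_shift:
  fixes h k :: "'a::euclidean_space \<Rightarrow> 'b::euclidean_space"
  assumes K: "compact K" "K \<noteq> {}" and h: "continuous_on K h"
    and le: "\<And>x. x \<in> K \<Longrightarrow> norm (k x) \<le> norm (h x) + d"
  shows "(SUP x\<in>K. norm (k x)) \<le> (SUP x\<in>K. norm (h x)) + d"
proof (rule cSUP_least[OF K(2)])
  fix x assume x: "x \<in> K"
  have "compact ((\<lambda>x. norm (h x)) ` K)"
    using h K(1) by (intro compact_continuous_image continuous_intros)
  then have "norm (h x) \<le> (SUP x\<in>K. norm (h x))"
    using x by (intro cSUP_upper bounded_imp_bdd_above compact_imp_bounded)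
  with le[OF x] show "norm (k x) \<le> (SUP x\<in>K. norm (h x)) + d" by linarith
qed

text \<open>A triangle inequality. The term \<open>0 - f x\<close> keeps the form in which a
  generating set centred at \<open>f\<close> tests the zero field; for partial derivatives the
  direction is a unit vector.\<close>

lemma C1c_seminorm_le:
  assumes p: "p \<in> C1c_seminorms W" and X: "X \<in> C1c W" "C1_bounded UNIV X d" and f: "f \<in> C1c W"
  shows "p (\<lambda>x. X x - f x) \<le> p (\<lambda>x. 0 - f x) + d"
proof -
  have X1: "C1_map UNIV X" using X(1) by (simp add: C1c_iff)
  have f1: "C1_map UNIV f" "C1_map UNIV (\<lambda>x. 0 - f x)"
    using f C1c_diff[OF C1c_zero f] by (simp_all add: C1c_iff)
  consider K where "compact K" "K \<noteq> {}" "p = (\<lambda>X. SUP x\<in>K. norm (X x))"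
    | K i where "compact K" "K \<noteq> {}" "p = (\<lambda>X. SUP x\<in>K. norm (partial i X x))"
    using p unfolding C1c_seminorms_def by blast
  then show ?thesis
  proof cases
    case 1
    have "norm (X x - f x) \<le> norm (0 - f x) + d" for x
      using C1_boundedD(1)[OF X(2), of x] norm_triangle_ineq4[of "X x" "f x"] by simp
    then show ?thesis
      unfolding 1(3) using C1_map_continuous_on[OF f1(2)]
      by (intro SUP_norm_le_shift 1) (auto elim: continuous_on_subset)
  next
    case 2
    have partial_diff: "partial i (\<lambda>x. Y x - f x) x = partial i Y x - partial i f x" if "C1_map UNIV Y" for Y x
      using frechet_derivative_at[OF has_derivative_diff[OF
          C1_map_has_derivative[OF that UNIV_I] C1_map_has_derivative[OF f1(1) UNIV_I]], of x]
      by (simp add: partial_def fun_eq_iff)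
    have zero: "partial i (\<lambda>x. 0) x = 0" for x by (simp add: partial_def)
    have "norm (partial i X x) \<le> d" for x
      using C1_boundedD(2)[OF X(2) UNIV_I, of x "axis i 1"] by (simp add: partial_def norm_axis_1)
    then have "norm (partial i (\<lambda>x. X x - f x) x) \<le> norm (partial i (\<lambda>x. 0 - f x) x) + d" for x
      unfolding partial_diff[OF X1] partial_diff[OF C1_map_const] zero
      using norm_triangle_ineq4[of "partial i X x" "partial i f x"] by (smt (verit) diff_0 norm_minus_cancel)
    moreover have "continuous_on K (partial i (\<lambda>x. 0 - f x))"
      unfolding partial_def[abs_def]
      using C1_map_continuous_derivative[OF f1(2)] by (rule continuous_on_subset) simp
    ultimately show ?thesis
      unfolding 2(3) by (intro SUP_norm_le_shift 2)
  qed
qed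

text \<open>Global C^1 bounds dominate every seminorm. Following the generation of the open set, an
  intersection takes the smaller radius, a union inherits one, and a generating set uses its slack
  at zero.\<close>

lemma C1c_topology_neighbourhood_zero:
  assumes S: "openin (C1c_topology W) S" and zero: "(\<lambda>x. 0) \<in> S"
  shows "\<exists>d>0. \<forall>X\<in>C1c W. C1_bounded UNIV X d \<longrightarrow> X \<in> S"
proof -
  have "generate_topology_on {{g \<in> C1c W. p (\<lambda>x. g x - f x) < e} | f p e.
      f \<in> C1c W \<and> p \<in> C1c_seminorms W \<and> e > 0} S"
    using S by (simp add: C1c_topology_def seminorm_topology_def openin_topology_generated_by_iff)
  then show ?thesis
    using zero
  proof (induction rule: generate_topology_on.induct)
    case (Int a b)
    then obtain d e where de: "d > 0" "e > 0" "\<forall>X\<in>C1c W. C1_bounded UNIV X d \<longrightarrow> X \<in> a"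
      "\<forall>X\<in>C1c W. C1_bounded UNIV X e \<longrightarrow> X \<in> b"
      by blast
    have "X \<in> a \<inter> b" if "X \<in> C1c W" "C1_bounded UNIV X (min d e)" for X
      using de(3,4) that(1) C1_bounded_mono[OF that(2) min.cobounded1]
        C1_bounded_mono[OF that(2) min.cobounded2] by blast
    with de(1,2) show ?case by (intro exI[of _ "min d e"]) auto
  next
    case (UN K)
    then obtain k where k: "k \<in> K" "(\<lambda>x. 0) \<in> k" by blast
    from UN.IH[OF k] obtain d where "d > 0" "\<forall>X\<in>C1c W. C1_bounded UNIV X d \<longrightarrow> X \<in> k" by blast
    with k(1) show ?case by (intro exI[of _ d]) blast
  next
    case (Basis s)
    then obtain f p e where s: "s = {g \<in> C1c W. p (\<lambda>x. g x - f x) < e}"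
      and f: "f \<in> C1c W" and p: "p \<in> C1c_seminorms W"
      by blast
    \<comment> \<open>The set is centred at \<open>f\<close>, not at zero. The slack is positive
      because zero belongs to the set, and half of it keeps the inequality strict.\<close>
    define d where "d = (e - p (\<lambda>x. 0 - f x)) / 2"
    have "d > 0" using Basis.prems by (simp add: s d_def)
    moreover have "X \<in> s" if "X \<in> C1c W" "C1_bounded UNIV X d" for X
    proof -
      have lin: "a < e" if "a \<le> b + (e - b) / 2" "0 < (e - b) / 2" for a b :: real
        using that by (simp add: field_simps)
      have "p (\<lambda>x. X x - f x) < e"
        using C1c_seminorm_le[OF p that f] \<open>d > 0\<close> unfolding d_def by (rule lin)
      then show ?thesis using that(1) by (simp add: s)
    qed
    ultimately show ?case by blast
  qed simp
qed

text \<open>The fields with C^1 bound \<open>e\<close> are mapped into the interval from -1 to 1;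
  rescaling by \<open>e / d\<close> gives the constant \<open>1 / e\<close>.\<close>

lemma C1c_functional_bounded:
  fixes W :: "(real^'n) set"
  assumes lin: "linear_functional_on (C1c W) T"
    and cont: "continuous_map (C1c_topology W) euclideanreal T" and W: "W \<noteq> {}"
  obtains C where "C > 0" "\<And>X d. X \<in> C1c W \<Longrightarrow> C1_bounded UNIV X d \<Longrightarrow> d > 0 \<Longrightarrow> \<bar>T X\<bar> \<le> C * d"
proof -
  have scale: "\<forall>f\<in>C1c W. \<forall>c. T (\<lambda>x. c *\<^sub>R f x) = c * T f"
    using lin by (simp add: linear_functional_on_def)
  have T0: "T (\<lambda>x. 0) = 0"
    using scale[THEN bspec, OF C1c_zero, THEN spec, of 0] by simp
  \<comment> \<open>The space of a generated topology is the union of its generating sets, so zero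
    must be exhibited in one of them; a point of \<open>W\<close> supplies a seminorm for
    it.\<close>
  have top: "(\<lambda>x. 0) \<in> topspace (C1c_topology W)"
  proof -
    obtain w where w: "w \<in> W" using W by blast
    define p where "p X = (SUP x\<in>{w}. norm (X x))" for X :: "real^'n \<Rightarrow> real^'n"
    have "p \<in> C1c_seminorms W"
      unfolding C1c_seminorms_def p_def[abs_def]
      by (rule UnI1, rule CollectI, rule exI[of _ "{w}"]) (use w in auto)
    then have "openin (C1c_topology W) {g \<in> C1c W. p (\<lambda>x. g x - 0) < 1}"
      unfolding C1c_topology_def seminorm_topology_def using C1c_zero[of W]
      by (intro topology_generated_by_Basis CollectI exI[of _ "\<lambda>x. 0"] exI[of _ p] exI[of _ "1::real"]) auto
    moreover have "(\<lambda>x. 0) \<in> {g \<in> C1c W. p (\<lambda>x. g x - 0) < 1}"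
      by (simp add: C1c_zero p_def)
    ultimately show ?thesis using openin_subset by blast
  qed
  have "openin (C1c_topology W) {X \<in> topspace (C1c_topology W). T X \<in> {-1<..<1}}"
    using cont by (rule openin_continuous_map_preimage) simp
  from C1c_topology_neighbourhood_zero[OF this] T0 top
  obtain e where e: "e > 0" "\<And>X. X \<in> C1c W \<Longrightarrow> C1_bounded UNIV X e \<Longrightarrow> \<bar>T X\<bar> < 1"
    by (auto simp: abs_less_iff)
  have "\<bar>T X\<bar> \<le> (1 / e) * d" if X: "X \<in> C1c W" "C1_bounded UNIV X d" "d > 0" for X d
  proof -
    have "C1_bounded UNIV (\<lambda>x. (e / d) *\<^sub>R X x) e"
    proof (rule C1_boundedI)
      have X1: "C1_map UNIV X" using X(1) by (simp add: C1c_iff)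
      then show "C1_map UNIV (\<lambda>x. (e / d) *\<^sub>R X x)" by (rule C1_map_scaleR[OF C1_map_const])
      show "((\<lambda>x. (e / d) *\<^sub>R X x) has_derivative (\<lambda>v. (e / d) *\<^sub>R frechet_derivative X (at x) v)) (at x)" for x
        by (intro has_derivative_scaleR_right C1_map_has_derivative[OF X1 UNIV_I])
      have "(e / d) * norm y \<le> e * b" if "norm y \<le> d * b" for y :: "real^'n" and b
        using mult_left_mono[OF that, of "e / d"] e(1) X(3) by simp
      then show "norm ((e / d) *\<^sub>R X x) \<le> e" "norm ((e / d) *\<^sub>R frechet_derivative X (at x) v) \<le> e * norm v" for x v
        using C1_boundedD[OF X(2) UNIV_I] e(1) X(3) mult.right_neutral[of e] mult.right_neutral[of d]
        by (metis abs_of_pos divide_pos_pos norm_scaleR)+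
    qed
    then have "\<bar>T (\<lambda>x. (e / d) *\<^sub>R X x)\<bar> < 1" by (intro e(2) C1c_scaleR X)
    moreover have "T (\<lambda>x. (e / d) *\<^sub>R X x) = (e / d) * T X"
      using scale X(1) by blast
    ultimately show ?thesis using e(1) X(3) by (simp add: abs_mult field_simps)
  qed
  moreover have "1 / e > 0" using e(1) by simp
  ultimately show thesis using that by blast
qed

text \<open>The hypothesis controls differences, so around each \<open>f\<close> the generating ball
  centred at \<open>f\<close> is enough and no triangle inequality for \<open>C1_norm\<close>
  enters.\<close>

lemma continuous_map_C1_topology:
  assumes M: "M \<noteq> {}"
    and h: "\<And>e. e > 0 \<Longrightarrow> \<exists>d>0. \<forall>f\<in>C1 M. \<forall>g\<in>C1 M. C1_norm M (\<lambda>x. g x - f x) < d \<longrightarrow> \<bar>h g - h f\<bar> < e"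
  shows "continuous_map (C1_topology M) euclideanreal h"
proof -
  let ?B = "{{g \<in> C1 M. p (\<lambda>x. g x - f x) < e} | f p e. f \<in> C1 M \<and> p \<in> {C1_norm M} \<and> e > 0}"
  have top_def: "C1_topology M = topology_generated_by ?B"
    by (simp add: C1_topology_def seminorm_topology_def)
  have top: "topspace (C1_topology M) \<subseteq> C1 M"
    unfolding top_def topology_generated_by_topspace by blast
  have "openin (C1_topology M) {f \<in> topspace (C1_topology M). h f \<in> U}" if U: "open U" for U
  proof (subst openin_subopen, intro ballI)
    fix f assume f: "f \<in> {f \<in> topspace (C1_topology M). h f \<in> U}"
    then have fM: "f \<in> C1 M" using top by blast
    obtain e where e: "e > 0" "\<And>y. \<bar>y - h f\<bar> < e \<Longrightarrow> y \<in> U"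
      using U f unfolding open_dist dist_real_def by blast
    obtain d where d: "d > 0" "\<And>g. g \<in> C1 M \<Longrightarrow> C1_norm M (\<lambda>x. g x - f x) < d \<Longrightarrow> \<bar>h g - h f\<bar> < e"
      using h[OF e(1)] fM by blast
    let ?S = "{g \<in> C1 M. C1_norm M (\<lambda>x. g x - f x) < d}"
    have S: "openin (C1_topology M) ?S"
      unfolding top_def by (rule topology_generated_by_Basis) (use fM d(1) in blast)
    moreover have "f \<in> ?S" using fM d(1) C1_norm_const_zero[OF M] by simp
    moreover have "?S \<subseteq> {f \<in> topspace (C1_topology M). h f \<in> U}"
      using d(2) e(2) openin_subset[OF S] by blast
    ultimately show "\<exists>T. openin (C1_topology M) T \<and> f \<in> T \<and> T \<subseteq> {f \<in> topspace (C1_topology M). h f \<in> U}"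
      by blast
  qed
  then show ?thesis by (simp add: continuous_map_def)
qed

section \<open>The structure theorem\<close>

lemma linear_functional_on_add:
  "linear_functional_on V T \<Longrightarrow> f \<in> V \<Longrightarrow> g \<in> V \<Longrightarrow> T (\<lambda>x. f x + g x) = T f + T g"
  by (simp add: linear_functional_on_def)

lemma linear_functional_on_scaleR:
  "linear_functional_on V T \<Longrightarrow> f \<in> V \<Longrightarrow> T (\<lambda>x. a *\<^sub>R f x) = a * T f"
  by (simp add: linear_functional_on_def)

lemma linear_functional_on_C1c_diff:
  assumes T: "linear_functional_on (C1c W) T" and X: "X \<in> C1c W" and Y: "Y \<in> C1c W"
  shows "T (\<lambda>x. X x - Y x) = T X - T Y"
  using linear_functional_on_add[OF T X C1c_scaleR[OF Y, of "-1"]]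
    linear_functional_on_scaleR[OF T Y, of "-1"] by simp

lemma linear_functional_on_C1c_sum:
  assumes T: "linear_functional_on (C1c W) T" and A: "finite A" and X: "\<And>i. i \<in> A \<Longrightarrow> X i \<in> C1c W"
  shows "T (\<lambda>x. \<Sum>i\<in>A. X i x) = (\<Sum>i\<in>A. T (X i))"
  using A X
proof (induction A rule: finite_induct)
  case empty
  show ?case using linear_functional_on_scaleR[OF T C1c_zero, of 0] by simp
next
  case (insert i A)
  have "T (\<lambda>x. X i x + (\<Sum>i\<in>A. X i x)) = T (X i) + T (\<lambda>x. \<Sum>i\<in>A. X i x)"
    using insert by (intro linear_functional_on_add[OF T] C1c_sum) auto
  with insert show ?case by simp
qed

text \<open>Two extensions of the same multiple of \<open>n\<close> differ by a field vanishing on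
  \<open>M\<close>, so \<open>T\<close> does not see the choice made by \<open>ext\<close>.
  Linearity can then be tested on sums and multiples of any extensions.\<close>

lemma extension_functional:
  fixes M W :: "(real^'n) set" and n :: "real^'n \<Rightarrow> real^'n"
  assumes M: "compact M" "M \<noteq> {}" "smooth_submanifold 1 M" and W: "open W" "M \<subseteq> W"
    and n: "Ck_along \<infinity> M n"
    and T: "linear_functional_on (C1c W) T" "continuous_map (C1c_topology W) euclideanreal T"
    and T_vanish: "\<forall>X\<in>C1c W. (\<forall>x\<in>M. X x = 0) \<longrightarrow> T X = 0"
  obtains h where "linear_functional_on (C1 M) h" "continuous_map (C1_topology M) euclideanreal h"
    "\<forall>f. \<forall>X\<in>C1c W. (\<forall>x\<in>M. X x = f x *\<^sub>R n x) \<longrightarrow> h f = T X"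
proof -
  obtain C where C: "C \<ge> 0" "\<And>f. f \<in> C1 M \<Longrightarrow>
      \<exists>X\<in>C1c W. C1_bounded UNIV X (C * C1_norm M f) \<and> (\<forall>x\<in>M. X x = f x *\<^sub>R n x)"
    by (rule field_extension[OF M W n]) (rule that)
  have W_ne: "W \<noteq> {}" using M(2) W(2) by blast
  obtain K where K: "K > 0" "\<And>X d. X \<in> C1c W \<Longrightarrow> C1_bounded UNIV X d \<Longrightarrow> d > 0 \<Longrightarrow> \<bar>T X\<bar> \<le> K * d"
    by (rule C1c_functional_bounded[OF T W_ne]) (rule that)
  define ext where "ext f = (SOME X. X \<in> C1c W \<and> (\<forall>x\<in>M. X x = f x *\<^sub>R n x))" for f
  define h where "h f = T (ext f)" for f
  have h_eq: "h f = T X" if X: "X \<in> C1c W" "\<And>x. x \<in> M \<Longrightarrow> X x = f x *\<^sub>R n x" for f X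
  proof -
    have "\<exists>X. X \<in> C1c W \<and> (\<forall>x\<in>M. X x = f x *\<^sub>R n x)" using X by blast
    then have ext_f: "ext f \<in> C1c W \<and> (\<forall>x\<in>M. ext f x = f x *\<^sub>R n x)"
      unfolding ext_def by (rule someI_ex)
    have diff: "(\<lambda>x. ext f x - X x) \<in> C1c W" using ext_f X(1) by (intro C1c_diff) auto
    have "\<forall>x\<in>M. ext f x - X x = 0" using ext_f X(2) by simp
    then have "T (\<lambda>x. ext f x - X x) = 0" by (rule T_vanish[THEN bspec, OF diff, THEN mp])
    then show ?thesis
      using linear_functional_on_C1c_diff[OF T(1), of "ext f" X] ext_f X(1) by (simp add: h_def)
  qed
  \<comment> \<open>For continuity the difference \<open>g x - f x\<close> is extended with a bound;
    the chosen fields \<open>ext g\<close> and \<open>ext f\<close> carry none.\<close>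
  have h_diff: "\<exists>X\<in>C1c W. C1_bounded UNIV X (C * C1_norm M (\<lambda>x. g x - f x)) \<and> h g - h f = T X"
    if f: "f \<in> C1 M" and g: "g \<in> C1 M" for f g
  proof -
    obtain X where X: "X \<in> C1c W" "C1_bounded UNIV X (C * C1_norm M (\<lambda>x. g x - f x))"
      "\<forall>x\<in>M. X x = (g x - f x) *\<^sub>R n x"
      using C(2)[OF C1_diff[OF g f]] by blast
    obtain Y where Y: "Y \<in> C1c W" "\<forall>x\<in>M. Y x = f x *\<^sub>R n x" using C(2)[OF f] by blast
    have "h g = T (\<lambda>x. X x + Y x)"
      using X(1,3) Y by (intro h_eq C1c_add) (auto simp: scaleR_diff_left)
    moreover have "T (\<lambda>x. X x + Y x) = T X + T Y"
      by (rule linear_functional_on_add[OF T(1) X(1) Y(1)])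
    moreover have "h f = T Y" using Y by (intro h_eq) auto
    ultimately show ?thesis using X(1,2) by (intro bexI[of _ X]) simp_all
  qed
  show thesis
  proof (rule that)
    show "linear_functional_on (C1 M) h"
      unfolding linear_functional_on_def
    proof (intro conjI ballI allI)
      fix f assume "f \<in> C1 M"
      then obtain X where X: "X \<in> C1c W" "\<forall>x\<in>M. X x = f x *\<^sub>R n x" using C(2) by blast
      then have hf: "h f = T X" by (intro h_eq) auto
      show "h (\<lambda>x. a *\<^sub>R f x) = a * h f" for a
      proof -
        have "h (\<lambda>x. a *\<^sub>R f x) = T (\<lambda>x. a *\<^sub>R X x)"
          using X by (intro h_eq C1c_scaleR) auto
        also have "\<dots> = a * T X" by (rule linear_functional_on_scaleR[OF T(1) X(1)])
        finally show ?thesis using hf by simp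
      qed
      fix g assume "g \<in> C1 M"
      then obtain Y where Y: "Y \<in> C1c W" "\<forall>x\<in>M. Y x = g x *\<^sub>R n x" using C(2) by blast
      then have hg: "h g = T Y" by (intro h_eq) auto
      have "h (\<lambda>x. f x + g x) = T (\<lambda>x. X x + Y x)"
        using X Y by (intro h_eq C1c_add) (auto simp: scaleR_add_left)
      also have "\<dots> = T X + T Y" by (rule linear_functional_on_add[OF T(1) X(1) Y(1)])
      finally show "h (\<lambda>x. f x + g x) = h f + h g" using hf hg by simp
    qed
    show "continuous_map (C1_topology M) euclideanreal h"
    proof (rule continuous_map_C1_topology[OF M(2)])
      fix e :: real assume e: "e > 0"
      \<comment> \<open>The summand 1 keeps the denominator and the bound \<open>(C + 1) * d\<close>
        positive when \<open>C = 0\<close>; the factor 2 makes the final inequality strict.\<close>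
      define d where "d = e / (2 * K * (C + 1))"
      have d: "d > 0" using e K(1) C(1) by (simp add: d_def)
      have "\<bar>h g - h f\<bar> < e" if fg: "f \<in> C1 M" "g \<in> C1 M" "C1_norm M (\<lambda>x. g x - f x) < d" for f g
      proof -
        obtain X where X: "X \<in> C1c W" "C1_bounded UNIV X (C * C1_norm M (\<lambda>x. g x - f x))" "h g - h f = T X"
          using h_diff[OF fg(1,2)] by blast
        have "C * C1_norm M (\<lambda>x. g x - f x) \<le> C * d" using C(1) fg(3) by (intro mult_left_mono) auto
        also have "\<dots> \<le> (C + 1) * d" using d by simp
        finally have "C1_bounded UNIV X ((C + 1) * d)" by (rule C1_bounded_mono[OF X(2)])
        moreover have "(C + 1) * d > 0" using C(1) d by simp
        ultimately have "\<bar>T X\<bar> \<le> K * ((C + 1) * d)" by (rule K(2)[OF X(1)])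
        also have "\<dots> = e / 2" using K(1) C(1) by (simp add: d_def)
        also have "\<dots> < e" using e by simp
        finally show ?thesis using X(3) by simp
      qed
      with d show "\<exists>d>0. \<forall>f\<in>C1 M. \<forall>g\<in>C1 M. C1_norm M (\<lambda>x. g x - f x) < d \<longrightarrow> \<bar>h g - h f\<bar> < e"
        by blast
    qed
  qed (simp add: h_eq)
qed

text \<open>In a chart the field is a constant multiple of the velocity \<open>c'\<close>, cut off before it reaches \<open>q\<close>.\<close>

lemma tangential_field_at:
  fixes M W :: "(real^'n) set"
  assumes M: "smooth_submanifold 1 M" and W: "open W" "M \<subseteq> W" and p: "p \<in> M"
    and v: "v \<in> tangent_space M p"
  obtains V where "V \<in> C1c W" "V p = v" "\<And>x. x \<in> M \<Longrightarrow> V x \<in> tangent_space M x" "q \<noteq> p \<Longrightarrow> V q = 0"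
proof -
  obtain r \<delta> c c' \<tau> I where arc: "arc_chart M p r \<delta> c c' \<tau> I"
    by (rule arc_chart_at[OF M p]) (rule that)
  interpret arc_chart M p r \<delta> c c' \<tau> I by (rule arc)
  define a where "a = frechet_derivative \<tau> (at p) v"
  have v_eq: "v = a *\<^sub>R c' (\<tau> p)"
    unfolding a_def by (rule tangent_eq[OF p _ v]) (use r_pos in simp)
  obtain d where d: "d > 0" "cball p d \<subseteq> W" using W p open_contains_cball by blast
  \<comment> \<open>The support must fit into \<open>W\<close> and into the chart, and stop short of
    \<open>q\<close> if that is another point.\<close>
  define R where "R = (if q = p then min d (r/2) else min (min d (r/2)) (dist p q / 2))"
  have R: "R > 0" "R \<le> d" "R \<le> r/2" "q \<noteq> p \<Longrightarrow> R < dist p q"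
    using d(1) r_pos by (auto simp: R_def min_less_iff_disj)
  obtain \<eta> :: "real^'n \<Rightarrow> real" and B where \<eta>: "C1_bounded UNIV \<eta> B"
    and \<eta>1: "\<And>x. x \<in> ball p (R/2) \<Longrightarrow> \<eta> x = 1" and \<eta>0: "\<And>x. x \<notin> cball p R \<Longrightarrow> \<eta> x = 0"
    by (rule C1_cutoff[OF R(1), of p]) (rule that)
  define V where "V x = \<eta> x *\<^sub>R (a *\<^sub>R c' (\<tau> x))" for x
  have sub: "cball p R \<subseteq> ball p r" using R(3) r_pos by (auto simp: subset_eq)
  show thesis
  proof (rule that)
    have "C1_map (ball p r) \<eta>" using \<eta> C1_map_subset unfolding C1_bounded_def by blast
    then have "C1_map (ball p r) V"
      unfolding V_def[abs_def]
      by (rule C1_map_scaleR[OF _ C1_map_scaleR[OF C1_map_const C1_map_compose[OF c'_C1 \<tau>_C1 \<tau>_maps]]])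
    then have "C1_map UNIV V"
      by (rule C1_map_extend_zero[OF _ open_ball closed_cball sub]) (simp add: V_def \<eta>0)
    moreover have "cball p R \<subseteq> W" using d(2) subset_cball[OF R(2)] by blast
    moreover have "\<forall>x. x \<notin> cball p R \<longrightarrow> V x = 0" using \<eta>0 by (simp add: V_def)
    ultimately show "V \<in> C1c W" unfolding C1c_iff using compact_cball by blast
    show "V p = v" using \<eta>1[of p] R(1) v_eq by (simp add: V_def)
    show "V x \<in> tangent_space M x" if x: "x \<in> M" for x
    proof (cases "x \<in> ball p r")
      case True
      then have "c' (\<tau> x) \<in> tangent_space M x"
        using velocity_in_tangent_space[OF \<tau>_less[OF True] \<tau>_in[OF x True]] c_\<tau>[OF x True] by simp
      then show ?thesis unfolding V_def tangent_space_def by (intro span_scale)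
    next
      case False
      then have "x \<notin> cball p R" using sub by blast
      then have "V x = 0" by (simp add: V_def \<eta>0)
      then show ?thesis by (simp add: tangent_space_def span_zero)
    qed
    show "V q = 0" if "q \<noteq> p"
      using \<eta>0[of q] R(4)[OF that] by (simp add: V_def)
  qed
qed

text \<open>Both vectors are multiples of the same velocity. At an end point this turns a vanishing
  component along \<nu> into a vanishing tangential field.\<close>

lemma tangent_space_orthogonal_zero:
  fixes M :: "'a::euclidean_space set"
  assumes M: "smooth_submanifold 1 M" and p: "p \<in> M"
    and uv: "u \<in> tangent_space M p" "v \<in> tangent_space M p" "u \<bullet> v = 0" "v \<noteq> 0"
  shows "u = 0"
proof -
  obtain r \<delta> c c' \<tau> I where arc: "arc_chart M p r \<delta> c c' \<tau> I"
    by (rule arc_chart_at[OF M p]) (rule that)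
  have pr: "p \<in> ball p r" using arc_chart.r_pos[OF arc] by simp
  obtain a b where "u = a *\<^sub>R c' (\<tau> p)" "v = b *\<^sub>R c' (\<tau> p)"
    using arc_chart.tangent_eq[OF arc p pr] uv(1,2) by blast
  with uv(3,4) show ?thesis by auto
qed

theorem corollary6p6:
  fixes D \<Omega> W M :: "(real^'n) set"
    and A B :: "real^'n"
    and \<Xi> :: "(real^'n) set set"
    and J :: "(real^'n) set \<Rightarrow> real"
    and \<nn> :: "nat \<Rightarrow> real^'n \<Rightarrow> real^'n"
    and \<nu> :: "real^'n \<Rightarrow> real^'n"
  assumes "open D" and "\<Omega> \<subseteq> D"
    and "open W" and "bounded W" and "smooth_boundary W"
    and "closed M" and "bounded M" and "simply_connected M"
    and "smooth_submanifold 1 M" and "mfd_boundary 1 M = {A, B}"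
    and "M \<subseteq> W" and "\<Omega> = W - M"
    and "\<forall>X\<in>C1c W. \<exists>L. has_eulerian_semideriv \<Xi> J \<Omega> X L"
    and "linear_functional_on (C1c W) (eulerian_semideriv \<Xi> J \<Omega>)"
    and "continuous_map (C1c_topology W) euclideanreal (eulerian_semideriv \<Xi> J \<Omega>)"
    and "\<forall>i\<in>{1..CARD('n) - 1}. Ck_along \<infinity> M (\<nn> i)"
    and "\<forall>p\<in>M. \<forall>i\<in>{1..CARD('n) - 1}. \<forall>j\<in>{1..CARD('n) - 1}.
           \<nn> i p \<bullet> \<nn> j p = (if i = j then 1 else 0)"
    and "\<forall>p\<in>M. span ((\<lambda>i. \<nn> i p) ` {1..CARD('n) - 1}) = orthogonal_comp (tangent_space M p)"
    and "\<forall>p\<in>{A, B}. outward_unit M p (\<nu> p)"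
  shows "\<exists>(h :: nat \<Rightarrow> (real^'n \<Rightarrow> real) \<Rightarrow> real) \<alpha>\<^sub>1 \<alpha>\<^sub>2.
           (\<forall>i\<in>{1..CARD('n) - 1}. linear_functional_on (C1 M) (h i) \<and>
              continuous_map (C1_topology M) euclideanreal (h i)) \<and>
           (\<forall>X\<in>C1c W. eulerian_semideriv \<Xi> J \<Omega> X =
              \<alpha>\<^sub>1 * (X A \<bullet> \<nu> A) + \<alpha>\<^sub>2 * (X B \<bullet> \<nu> B) +
              (\<Sum>i=1..CARD('n) - 1. h i (\<lambda>p. X p \<bullet> \<nn> i p)))"
proof -
  let ?I = "{1..CARD('n) - 1}"
  define T where "T = eulerian_semideriv \<Xi> J \<Omega>"
  note T_lin = assms(14)[folded T_def] and T_cont = assms(15)[folded T_def]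
  note W = assms(3,11) and submfd = assms(9) and orthonormal = assms(17) and span_eq = assms(18)
  have M: "compact M" using assms(6,7) by (simp add: compact_eq_bounded_closed)
  have bdry: "mfd_boundary_point 1 M A" "mfd_boundary_point 1 M B"
    using assms(10) unfolding mfd_boundary_def by blast+
  then have AB: "A \<in> M" "B \<in> M" by (simp_all add: mfd_boundary_point_def)
  then have M_ne: "M \<noteq> {}" by blast
  have \<nu>: "\<nu> p \<in> tangent_space M p" "norm (\<nu> p) = 1" if "p \<in> {A, B}" for p
    using assms(19) that by (auto simp: outward_unit_def)
  have T_vanish: "T R = 0" if R: "R \<in> C1c W" "\<And>x. x \<in> M \<Longrightarrow> R x \<in> tangent_space M x" "R A = 0" "R B = 0" for R
    unfolding T_def assms(12)
  proof (rule eulerian_semideriv_tangential[OF R(1) assms(6) submfd R(2)])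
    show "R x = 0" if "x \<in> mfd_boundary 1 M" for x using that R(3,4) assms(10) by auto
    show "\<exists>L. has_eulerian_semideriv \<Xi> J (W - M) R L" using assms(12,13) R(1) by blast
  qed
  have T_zero: "\<forall>R\<in>C1c W. (\<forall>x\<in>M. R x = 0) \<longrightarrow> T R = 0"
    using AB by (auto intro!: T_vanish simp: tangent_space_def span_zero)
  have "\<forall>i\<in>?I. \<exists>h. linear_functional_on (C1 M) h \<and> continuous_map (C1_topology M) euclideanreal h \<and>
      (\<forall>f. \<forall>X\<in>C1c W. (\<forall>x\<in>M. X x = f x *\<^sub>R \<nn> i x) \<longrightarrow> h f = T X)"
  proof
    fix i assume i: "i \<in> ?I"
    have smooth: "Ck_along \<infinity> M (\<nn> i)" using assms(16) i by blast
    obtain h where "linear_functional_on (C1 M) h" "continuous_map (C1_topology M) euclideanreal h"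
      "\<forall>f. \<forall>X\<in>C1c W. (\<forall>x\<in>M. X x = f x *\<^sub>R \<nn> i x) \<longrightarrow> h f = T X"
      by (rule extension_functional[OF M M_ne submfd W smooth T_lin T_cont T_zero]) (rule that)
    then show "\<exists>h. linear_functional_on (C1 M) h \<and> continuous_map (C1_topology M) euclideanreal h \<and>
        (\<forall>f. \<forall>X\<in>C1c W. (\<forall>x\<in>M. X x = f x *\<^sub>R \<nn> i x) \<longrightarrow> h f = T X)"
      by (intro exI[of _ h]) blast
  qed
  then obtain h where h: "\<And>i. i \<in> ?I \<Longrightarrow> linear_functional_on (C1 M) (h i)"
      "\<And>i. i \<in> ?I \<Longrightarrow> continuous_map (C1_topology M) euclideanreal (h i)"
    and h_eq: "\<And>i f X. i \<in> ?I \<Longrightarrow> X \<in> C1c W \<Longrightarrow> \<forall>x\<in>M. X x = f x *\<^sub>R \<nn> i x \<Longrightarrow> h i f = T X"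
    by (metis (no_types, lifting))
  \<comment> \<open>\<open>T VA\<close> and \<open>T VB\<close> become the two coefficients.\<close>
  obtain VA where VA: "VA \<in> C1c W" "VA A = \<nu> A" "\<And>x. x \<in> M \<Longrightarrow> VA x \<in> tangent_space M x"
    "B \<noteq> A \<Longrightarrow> VA B = 0"
    by (rule tangential_field_at[OF submfd W AB(1) \<nu>(1), of B]) (use that in simp_all)
  obtain VB where VB: "VB \<in> C1c W" "VB A = 0" "B \<noteq> A \<Longrightarrow> VB B = \<nu> B"
    "\<And>x. x \<in> M \<Longrightarrow> VB x \<in> tangent_space M x"
  proof (cases "B = A")
    case True
    show thesis
      by (rule that[of "\<lambda>x. 0"]) (use True in \<open>auto simp: C1c_zero tangent_space_def span_zero\<close>)
  next
    case False
    obtain V where "V \<in> C1c W" "V B = \<nu> B" "\<And>x. x \<in> M \<Longrightarrow> V x \<in> tangent_space M x"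
      "A \<noteq> B \<Longrightarrow> V A = 0"
      by (rule tangential_field_at[OF submfd W AB(2) \<nu>(1), of A]) (use that in simp_all)
    with False show thesis by (intro that[of V]) auto
  qed
  have normal: "u \<bullet> \<nn> i p = 0" if "p \<in> M" "i \<in> ?I" "u \<in> tangent_space M p" for u i p
  proof -
    have "\<nn> i p \<in> orthogonal_comp (tangent_space M p)"
      using span_eq that(1,2) span_base[of "\<nn> i p" "(\<lambda>i. \<nn> i p) ` ?I"] by blast
    then show ?thesis using that(3) by (simp add: orthogonal_comp_def orthogonal_def)
  qed
  \<comment> \<open>Orthogonality to the frame is membership in the double orthogonal complement of
    the tangent space, which is the tangent space again because that is a span.\<close>
  have tangent: "u \<in> tangent_space M p" if p: "p \<in> M" and u: "\<And>i. i \<in> ?I \<Longrightarrow> u \<bullet> \<nn> i p = 0" for u p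
  proof -
    have "orthogonal u w" if "w \<in> span ((\<lambda>i. \<nn> i p) ` ?I)" for w
      using that by (rule orthogonal_to_span) (auto simp: orthogonal_def u)
    then have "u \<in> orthogonal_comp (orthogonal_comp (tangent_space M p))"
      using span_eq p by (auto simp: orthogonal_comp_def orthogonal_commute)
    then show ?thesis by (simp add: orthogonal_comp_self tangent_space_def)
  qed
  have "T X = T VA * (X A \<bullet> \<nu> A) + T VB * (X B \<bullet> \<nu> B) + (\<Sum>i\<in>?I. h i (\<lambda>p. X p \<bullet> \<nn> i p))"
    if X: "X \<in> C1c W" for X
  proof -
    have "\<exists>Y\<in>C1c W. \<forall>x\<in>M. Y x = (X x \<bullet> \<nn> i x) *\<^sub>R \<nn> i x" if i: "i \<in> ?I" for i
    proof -
      have smooth: "Ck_along \<infinity> M (\<nn> i)" using assms(16) i by blast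
      have "(\<lambda>x. X x \<bullet> \<nn> i x) \<in> C1 M"
        unfolding C1_def Ck_along_def Ck_on_1_iff mem_Collect_eq
      proof
        fix p assume "p \<in> M"
        then obtain U F where U: "open U" "p \<in> U" "Ck_on \<infinity> U F" "\<forall>x\<in>M \<inter> U. F x = \<nn> i x"
          using smooth unfolding Ck_along_def by blast
        have "C1_map U X" using X C1_map_subset unfolding C1c_iff by blast
        then have "C1_map U (\<lambda>x. X x \<bullet> F x)"
          by (rule C1_map_inner[OF _ C1_map_of_smooth(1)[OF U(3)]])
        with U show "\<exists>U F. open U \<and> p \<in> U \<and> C1_map U F \<and> (\<forall>x\<in>M \<inter> U. F x = X x \<bullet> \<nn> i x)"
          by (intro exI[of _ U] exI[of _ "\<lambda>x. X x \<bullet> F x"]) auto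
      qed
      moreover obtain C where "C \<ge> 0" "\<And>f. f \<in> C1 M \<Longrightarrow>
          \<exists>X\<in>C1c W. C1_bounded UNIV X (C * C1_norm M f) \<and> (\<forall>x\<in>M. X x = f x *\<^sub>R \<nn> i x)"
        by (rule field_extension[OF M M_ne submfd W smooth]) (rule that)
      ultimately show ?thesis by blast
    qed
    then obtain Y where Y: "\<And>i. i \<in> ?I \<Longrightarrow> Y i \<in> C1c W"
      and Y_eq: "\<And>i x. i \<in> ?I \<Longrightarrow> x \<in> M \<Longrightarrow> Y i x = (X x \<bullet> \<nn> i x) *\<^sub>R \<nn> i x"
      by metis
    define Z where "Z x = X x - (\<Sum>i\<in>?I. Y i x)" for x
    define Z1 where "Z1 x = Z x - (X A \<bullet> \<nu> A) *\<^sub>R VA x" for x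
    define R where "R x = Z1 x - (X B \<bullet> \<nu> B) *\<^sub>R VB x" for x
    have sum_Y: "(\<lambda>x. \<Sum>i\<in>?I. Y i x) \<in> C1c W" by (rule C1c_sum) (simp_all add: Y)
    have Z: "Z \<in> C1c W" unfolding Z_def[abs_def] by (rule C1c_diff[OF X sum_Y])
    have Z1: "Z1 \<in> C1c W" unfolding Z1_def[abs_def] by (rule C1c_diff[OF Z C1c_scaleR[OF VA(1)]])
    have R: "R \<in> C1c W" unfolding R_def[abs_def] by (rule C1c_diff[OF Z1 C1c_scaleR[OF VB(1)]])
    note scale = linear_functional_on_scaleR[OF T_lin]
    have "T R = T Z1 - (X B \<bullet> \<nu> B) * T VB"
      unfolding R_def[abs_def]
      by (simp only: linear_functional_on_C1c_diff[OF T_lin Z1 C1c_scaleR[OF VB(1)]] scale[OF VB(1)])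
    moreover have "T Z1 = T Z - (X A \<bullet> \<nu> A) * T VA"
      unfolding Z1_def[abs_def]
      by (simp only: linear_functional_on_C1c_diff[OF T_lin Z C1c_scaleR[OF VA(1)]] scale[OF VA(1)])
    moreover have "T Z = T X - (\<Sum>i\<in>?I. T (Y i))"
      unfolding Z_def[abs_def]
      by (simp only: linear_functional_on_C1c_diff[OF T_lin X sum_Y]
          linear_functional_on_C1c_sum[OF T_lin finite_atLeastAtMost Y])
    moreover have "(\<Sum>i\<in>?I. T (Y i)) = (\<Sum>i\<in>?I. h i (\<lambda>p. X p \<bullet> \<nn> i p))"
    proof (rule sum.cong[OF refl])
      show "T (Y i) = h i (\<lambda>p. X p \<bullet> \<nn> i p)" if "i \<in> ?I" for i
        using h_eq[OF that Y[OF that], of "\<lambda>p. X p \<bullet> \<nn> i p"] Y_eq[OF that] by simp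
    qed
    moreover have "T R = 0"
    proof -
      have Z_tangent: "Z p \<in> tangent_space M p" if p: "p \<in> M" for p
      proof (rule tangent[OF p])
        fix j assume j: "j \<in> ?I"
        have "(\<Sum>i\<in>?I. Y i p) \<bullet> \<nn> j p = (\<Sum>i\<in>?I. (X p \<bullet> \<nn> i p) * (if i = j then 1 else 0))"
          unfolding inner_sum_left
        proof (rule sum.cong[OF refl])
          show "Y i p \<bullet> \<nn> j p = (X p \<bullet> \<nn> i p) * (if i = j then 1 else 0)" if i: "i \<in> ?I" for i
            using Y_eq[OF i p] orthonormal p i j by simp
        qed
        also have "\<dots> = X p \<bullet> \<nn> j p" using j by (simp add: if_distrib sum.delta cong: if_cong)
        finally show "Z p \<bullet> \<nn> j p = 0" by (simp add: Z_def inner_diff_left)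
      qed
      have R_tangent: "R p \<in> tangent_space M p" if p: "p \<in> M" for p
        using Z_tangent[OF p] VA(3)[OF p] VB(4)[OF p]
        unfolding R_def Z1_def tangent_space_def by (intro span_diff span_scale)
      \<comment> \<open>The frame is orthogonal to the tangent line, so removing normal parts leaves
        the component along \<nu> unchanged; the coefficients can be read off from \<open>X\<close>
        itself.\<close>
      have Z_\<nu>: "Z p \<bullet> \<nu> p = X p \<bullet> \<nu> p" if p: "p \<in> {A, B}" for p
      proof -
        have pM: "p \<in> M" using p AB by blast
        have "Y i p \<bullet> \<nu> p = 0" if i: "i \<in> ?I" for i
          using normal[OF pM i \<nu>(1)[OF p]] Y_eq[OF i pM] by (simp add: inner_commute)
        then have "(\<Sum>i\<in>?I. Y i p) \<bullet> \<nu> p = 0" unfolding inner_sum_left by (intro sum.neutral) blast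
        then show ?thesis by (simp add: Z_def inner_diff_left)
      qed
      have one: "\<nu> p \<bullet> \<nu> p = 1" "\<nu> p \<noteq> 0" if "p \<in> {A, B}" for p
        using \<nu>(2)[OF that] by (auto simp: dot_square_norm)
      \<comment> \<open>\<open>VB A = 0\<close> holds also when \<open>A = B\<close>, so at
        \<open>A\<close> the multiple of \<open>VA\<close> alone cancels the component along
        \<nu>.\<close>
      have "R A \<bullet> \<nu> A = 0"
        using Z_\<nu>[of A] one(1)[of A] by (simp add: R_def Z1_def inner_diff_left VA(2) VB(2))
      then have RA: "R A = 0"
        using tangent_space_orthogonal_zero[OF submfd AB(1) R_tangent[OF AB(1)] \<nu>(1)] one(2) by simp
      have RB: "R B = 0"
      proof (cases "B = A")
        case False
        have "R B \<bullet> \<nu> B = 0"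
          using Z_\<nu>[of B] one(1)[of B] False by (simp add: R_def Z1_def inner_diff_left VA(4) VB(3))
        then show ?thesis
          using tangent_space_orthogonal_zero[OF submfd AB(2) R_tangent[OF AB(2)] \<nu>(1)] one(2) by simp
      qed (use RA in simp)
      show ?thesis by (rule T_vanish[OF R R_tangent RA RB])
    qed
    ultimately show ?thesis by (simp add: algebra_simps)
  qed
  with h show ?thesis
    unfolding T_def by (intro exI[of _ h] exI[of _ "T VA"] exI[of _ "T VB"]) (simp add: T_def)
qed

end
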